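(* Let $(Z_t,X_t)_{t\ge 1}$ be the univariate discrete-time marked Hawkes process with base intensity $\nu>0$, exciting function $\alpha$ and i.i.d. positive marks $\ell_{t,j}$, with $\Vert\alpha\Vert_1\mathbb{E}[\ell_{1,1}]<1$ (as defined in the context), and let $N_t=\sum_{s=1}^{t}Z_s$. Assume that the first four moments of $\ell_{t,j}$ are finite and that $$\lim_{t\to\infty}\frac{1}{\sqrt{t}}\sum_{u=1}^{t-1}\sum_{s=1+u}^{\infty}\alpha(s)=0.$$ Then $$\frac{1}{\sqrt{t}}\left(N_t-\frac{\nu t}{1-\Vert\alpha\Vert_1\mathbb{E}[\ell_{1,1}]}\right)\longrightarrow N\left(0,\frac{\nu\left(1+\Vert\alpha\Vert_1^2\,\mathrm{Var}(\ell_{1,1})\right)}{(1-\Vert\alpha\Vert_1\mathbb{E}[\ell_{1,1}])^3}\right)$$ in distribution as $t\to\infty$, where $N(0,\sigma^2)$ denotes the normal distribution with mean $0$ and variance $\sigma^2$.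
   Context: Univariate discrete-time marked Hawkes process. Let $\nu>0$, let $\alpha:\mathbb{N}\cup\{0\}\to\mathbb{R}_+$ be a positive function, and put $\Vert\alpha\Vert_1:=\sum_{t=1}^{\infty}\alpha(t)$. Let $(\ell_{t,j})_{t\ge1,\,j\ge1}$ be positive random variables, i.i.d. in both $t$ and $j$, with finite mean. Set $X_0=N_0=0$. For $t\ge1$ let $$\lambda_t:=\nu+\sum_{s=1}^{t-1}\alpha(s)X_{t-s}$$ (so $\lambda_1=\nu$). Let $\mathcal{F}_t=\sigma(Z_s,X_s:1\le s\le t)$ be the natural filtration, with $\mathcal{F}_0$ trivial. Conditionally on $\mathcal{F}_{t-1}$, $Z_t$ is a Poisson random variable with mean $\lambda_t$, and $$X_t:=\sum_{j=1}^{Z_t}\ell_{t,j},$$ where the marks $(\ell_{t,j})_{j\ge1}$ at time $t$ are independent of $\sigma(\mathcal{F}_{t-1},Z_t)$. Standing assumption: $\Vert\alpha\Vert_1\mathbb{E}[\ell_{1,1}]<1$. Define $N_t:=\sum_{s=1}^tZ_s$ and $L_t:=\sum_{s=1}^tX_s$. *)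

theory Defs
  imports "HOL-Probability.Probability"
begin

definition sigma_gen :: "'a measure \<Rightarrow> 'i set \<Rightarrow> 'b measure \<Rightarrow> ('i \<Rightarrow> 'a \<Rightarrow> 'b) \<Rightarrow> 'a set set" where
  "sigma_gen M I N Y =
     sigma_sets (space M) (\<Union>i\<in>I. {Y i -` A \<inter> space M | A. A \<in> sets N})"

definition mark_sum ::
  "(nat \<Rightarrow> nat \<Rightarrow> 'a \<Rightarrow> real) \<Rightarrow> (nat \<Rightarrow> 'a \<Rightarrow> nat) \<Rightarrow> nat \<Rightarrow> 'a \<Rightarrow> real" where
  "mark_sum l Z t \<omega> = (if t = 0 then 0 else \<Sum>j = 1..Z t \<omega>. l t j \<omega>)"

definition intensity ::
  "real \<Rightarrow> (nat \<Rightarrow> real) \<Rightarrow> (nat \<Rightarrow> 'a \<Rightarrow> real) \<Rightarrow> nat \<Rightarrow> 'a \<Rightarrow> real" where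
  "intensity \<nu> \<alpha> X t \<omega> = \<nu> + (\<Sum>s = 1..t - 1. \<alpha> s * X (t - s) \<omega>)"

definition count_upto :: "(nat \<Rightarrow> 'a \<Rightarrow> nat) \<Rightarrow> nat \<Rightarrow> 'a \<Rightarrow> nat" where
  "count_upto Z t \<omega> = (\<Sum>s = 1..t. Z s \<omega>)"

definition past_sets ::
  "'a measure \<Rightarrow> (nat \<Rightarrow> 'a \<Rightarrow> nat) \<Rightarrow> (nat \<Rightarrow> 'a \<Rightarrow> real) \<Rightarrow> nat \<Rightarrow> 'a set set" where
  "past_sets M Z X t =
     sigma_sets (space M)
       (sigma_gen M {1..t} (count_space UNIV) Z \<union> sigma_gen M {1..t} borel X)"

text \<open>The natural filtration as a measure space, the format in which the library takes the
  sub-sigma-algebra of a conditional expectation; the measure it carries is irrelevant.\<close>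

definition past ::
  "'a measure \<Rightarrow> (nat \<Rightarrow> 'a \<Rightarrow> nat) \<Rightarrow> (nat \<Rightarrow> 'a \<Rightarrow> real) \<Rightarrow> nat \<Rightarrow> 'a measure" where
  "past M Z X t = sigma (space M) (past_sets M Z X t)"

text \<open>The sum starts at 1; \<open>\<alpha> 0\<close> does not enter.\<close>

definition l1_norm :: "(nat \<Rightarrow> real) \<Rightarrow> real" where
  "l1_norm \<alpha> = (\<Sum>\<^sub>\<infinity>t\<in>{1..}. \<alpha> t)"

text \<open>Positivity of the marks and the conditional law of \<open>Z t\<close> are almost sure statements.
  Summability of \<open>\<alpha>\<close> is explicit because a divergent \<open>infsum\<close> has value 0, so that the last
  assumption alone would not express that the norm is finite.\<close>

locale marked_hawkes = prob_space M for M :: "'a measure" +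
  fixes \<nu> :: real
    and \<alpha> :: "nat \<Rightarrow> real"
    and l :: "nat \<Rightarrow> nat \<Rightarrow> 'a \<Rightarrow> real"
    and Z :: "nat \<Rightarrow> 'a \<Rightarrow> nat"
  assumes base_pos: "0 < \<nu>"
    and exciting_pos: "0 < \<alpha> t"
    and exciting_summable: "\<alpha> summable_on {1..}"
    and marks_pos: "\<lbrakk>1 \<le> t; 1 \<le> j\<rbrakk> \<Longrightarrow> AE \<omega> in M. 0 < l t j \<omega>"
    and marks_indep: "indep_vars (\<lambda>_. borel) (\<lambda>(t, j). l t j) ({1..} \<times> {1..})"
    and marks_distr: "\<lbrakk>1 \<le> t; 1 \<le> j\<rbrakk> \<Longrightarrow> distr M borel (l t j) = distr M borel (l 1 1)"
    and marks_integrable: "integrable M (l 1 1)"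
    and counts_measurable: "1 \<le> t \<Longrightarrow> Z t \<in> measurable M (count_space UNIV)"
    and counts_cond_poisson:
      "1 \<le> t \<Longrightarrow>
         AE \<omega> in M. real_cond_exp M (past M Z (mark_sum l Z) (t - 1))
                      (indicator {\<omega> \<in> space M. Z t \<omega> = k}) \<omega>
                  = pmf (poisson_pmf (intensity \<nu> \<alpha> (mark_sum l Z) t \<omega>)) k"
    and marks_indep_past:
      "1 \<le> t \<Longrightarrow>
         indep_set (sigma_gen M {1..} borel (l t))
                   (sigma_sets (space M)
                      (past_sets M Z (mark_sum l Z) (t - 1) \<union>
                       sigma_gen M {t} (count_space UNIV) Z))"
    and subcritical: "l1_norm \<alpha> * expectation (l 1 1) < 1"

definition normal_distribution :: "real \<Rightarrow> real \<Rightarrow> real measure" where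
  "normal_distribution \<mu> v = density lborel (normal_density \<mu> (sqrt v))"

end

theory Submission
  imports Defs
begin

text \<open>
  Conditioning backwards in time, from \<open>t\<close> down to \<open>0\<close>, computes the characteristic function of
  \<open>N t\<close> exactly: given the past, \<open>(Z s, X s)\<close> is compound Poisson, and each step turns an
  exponential that is affine in \<open>Z s\<close> and \<open>X s\<close> into one that is affine in the intensity, hence in the
  earlier values of \<open>X\<close>. The result is \<open>E exp(i\<theta> N t) = exp(\<nu> (h 0 + ... + h (t - 1)))\<close> with
  \<open>h k = E exp(i\<theta> + c k \<ell>) - 1\<close> and \<open>c k = \<alpha> k h 0 + ... + \<alpha> 1 h (k - 1)\<close>. All real parts are
  nonpositive, so every exponential involved is bounded by 1.

  What remains is deterministic. Expanding \<open>h k\<close> to second order in \<open>\<theta>\<close> gives a perturbed renewal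
  equation, whose solution stays close to \<open>i\<theta> / (1 - \<alpha>\<^sub>1 E \<ell>)\<close>, where \<open>\<alpha>\<^sub>1\<close> is the norm of \<open>\<alpha>\<close>, except
  near the start. Summing the equation over \<open>k < t\<close> with \<open>\<theta> = x / sqrt t\<close>, the boundary terms are
  bounded by the sum of the tails of \<open>\<alpha>\<close> divided by \<open>sqrt t\<close>, which the hypothesis sends to 0, and
  the quadratic terms produce the variance. Levy's continuity theorem concludes.
\<close>

section \<open>Perturbed renewal equations\<close>

text \<open>Each \<open>f j\<close> collects the kernel at all lags that fit before
  \<open>t\<close>. The lags that do not fit become the boundary term in
  \<open>sum_c\<close>.\<close>

lemma sum_triangle_convolution:
  fixes \<alpha> f :: "nat \<Rightarrow> 'b::comm_semiring_1"
  shows "(\<Sum>k<t. \<Sum>j<k. \<alpha> (k - j) * f j) = (\<Sum>j<t. (\<Sum>i=1..t - Suc j. \<alpha> i) * f j)"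
proof (induction t)
  case (Suc t)
  have "(\<Sum>i=1..t - j. \<alpha> i) * f j = (\<Sum>i=1..t - Suc j. \<alpha> i) * f j + \<alpha> (t - j) * f j"
    if "j < t" for j
  proof -
    have "{1..t - j} = insert (t - j) {1..t - Suc j}" using that by auto
    moreover have "t - j \<notin> {1..t - Suc j}" using that by auto
    ultimately show ?thesis by (simp add: algebra_simps)
  qed
  then have "(\<Sum>j<t. (\<Sum>i=1..t - j. \<alpha> i) * f j) = (\<Sum>j<t. (\<Sum>i=1..t - Suc j. \<alpha> i) * f j) + (\<Sum>j<t. \<alpha> (t - j) * f j)"
    unfolding sum.distrib[symmetric] by (intro sum.cong) auto
  then show ?case using Suc by simp
qed simp

lemma sum_reflect_convolution_kernel:
  fixes \<alpha> :: "nat \<Rightarrow> 'b::comm_monoid_add"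
  shows "(\<Sum>j<k. \<alpha> (k - j)) = (\<Sum>i=1..k. \<alpha> i)"
  by (rule sum.reindex_bij_witness[of _ "\<lambda>i. k - i" "\<lambda>j. k - j"]) auto

text \<open>For the Hawkes process, \<open>a\<close> is the norm of \<alpha>, \<open>T k\<close> its
  tail beyond \<open>k\<close>, and \<open>m\<close>, \<open>q\<close> are the first two moments of
  a mark. The map from \<open>c k\<close> to \<open>h k\<close> enters only through its expansions
  at the origin to orders 0, 1 and 2, which keeps this section free of probability.\<close>

locale perturbed_renewal =
  fixes \<alpha> T :: "nat \<Rightarrow> real" and a m q K \<theta> :: real and h c :: "nat \<Rightarrow> complex"
  assumes kernel_nonneg: "0 \<le> \<alpha> i"
    and tail_nonneg: "0 \<le> T k"
    and partial_sums: "(\<Sum>i=1..k. \<alpha> i) = a - T k"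
    and m_nonneg: "0 \<le> m" and subcrit: "a * m < 1" and q_nonneg: "0 \<le> q" and K_nonneg: "0 \<le> K"
    and c_eq: "c k = (\<Sum>j<k. of_real (\<alpha> (k - j)) * h j)"
    and h_le: "norm (h k) \<le> \<bar>\<theta>\<bar> + m * norm (c k)"
    and h_lin: "norm (h k - (\<i> * \<theta> + m * c k)) \<le> 2 * \<theta>\<^sup>2 + 2 * q * (norm (c k))\<^sup>2"
    and h_quad: "norm (h k - (\<i> * \<theta> + m * c k) - (- (\<theta>\<^sup>2) + 2 * \<i> * \<theta> * m * c k + q * (c k)\<^sup>2) / 2)
            \<le> K * (\<bar>\<theta>\<bar> ^ 3 + norm (c k) ^ 3)"
begin

text \<open>\<open>\<i> * \<theta> * \<mu>\<close> is the constant solution of the linearised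
  equation with the full kernel, \<open>x = \<i> * \<theta> + m * a * x\<close>.\<close>

definition "\<mu> = 1 / (1 - a * m)"

lemma \<mu>_pos: "0 < \<mu>" and \<mu>_eq: "1 + m * a * \<mu> = \<mu>" and \<mu>_mult: "(1 - a * m) * \<mu> = 1"
  using subcrit by (auto simp: \<mu>_def field_simps)

lemma a_nonneg: "0 \<le> a"
  using partial_sums[of 0] tail_nonneg[of 0] by simp

lemma kernel_sum_le: "(\<Sum>i=1..k. \<alpha> i) \<le> a"
  using partial_sums tail_nonneg by simp

lemma convolution_le:
  assumes "\<And>j. j < k \<Longrightarrow> norm (f j :: complex) \<le> B" "0 \<le> B"
  shows "norm (\<Sum>j<k. of_real (\<alpha> (k - j)) * f j) \<le> a * B"
proof -
  have "norm (\<Sum>j<k. of_real (\<alpha> (k - j)) * f j) \<le> (\<Sum>j<k. \<alpha> (k - j) * B)"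
    by (rule sum_norm_le) (use assms kernel_nonneg in \<open>auto simp: norm_mult intro!: mult_left_mono\<close>)
  also have "\<dots> = (\<Sum>i=1..k. \<alpha> i) * B"
    by (simp add: sum_reflect_convolution_kernel flip: sum_distrib_right)
  also have "\<dots> \<le> a * B" using kernel_sum_le assms(2) by (rule mult_right_mono)
  finally show ?thesis .
qed

text \<open>The convolution costs a factor \<open>a\<close>, and \<mu> is the fixed point of
  \<open>x = 1 + m * a * x\<close>, so the bound reproduces itself in the induction.\<close>

lemma h_bound: "norm (h k) \<le> \<mu> * \<bar>\<theta>\<bar>"
proof (induction k rule: less_induct)
  case (less k)
  have "norm (c k) \<le> a * (\<mu> * \<bar>\<theta>\<bar>)"
    unfolding c_eq using less \<mu>_pos by (intro convolution_le) auto
  then have "m * norm (c k) \<le> m * (a * (\<mu> * \<bar>\<theta>\<bar>))"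
    using m_nonneg by (rule mult_left_mono)
  then have "norm (h k) \<le> (1 + m * a * \<mu>) * \<bar>\<theta>\<bar>"
    using h_le[of k] by (simp add: algebra_simps)
  then show ?case by (simp only: \<mu>_eq)
qed

text \<open>\<open>\<i> * \<theta> * b\<close> is the value of \<open>c\<close> that belongs to the
  constant solution.\<close>

definition "b = a * \<mu>"

lemma b_nonneg: "0 \<le> b" and b_eq: "b * m + 1 = \<mu>"
  using a_nonneg \<mu>_pos \<mu>_eq by (auto simp: b_def algebra_simps)

lemma c_bound: "norm (c k) \<le> b * \<bar>\<theta>\<bar>"
  unfolding c_eq b_def mult.assoc using h_bound \<mu>_pos by (intro convolution_le) auto

lemma convolution_sum_le:
  assumes "\<And>j. 0 \<le> f j"
  shows "(\<Sum>k<t. \<Sum>j<k. \<alpha> (k - j) * f j) \<le> a * (\<Sum>j<t. f j)"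
  unfolding sum_triangle_convolution sum_distrib_left
  by (intro sum_mono mult_right_mono kernel_sum_le assms)

definition "S t = (\<Sum>k<t. T k)"

text \<open>Deviations from the constant solution. For early \<open>k\<close> the convolution misses
  much of the kernel and they need not be small relative to \<theta>; what matters below is their
  sum over \<open>k\<close>.\<close>

definition "e k = h k - \<i> * \<theta> * \<mu>"
definition "d k = c k - \<i> * \<theta> * b"

text \<open>The constant part of \<open>h\<close> meets only the first \<open>k\<close> kernel
  values, whose sum falls short of \<open>a\<close> by \<open>T k\<close>. This deficit is the
  source term.\<close>

lemma d_eq: "d k = (\<Sum>j<k. of_real (\<alpha> (k - j)) * e j) - \<i> * \<theta> * \<mu> * T k"
proof -
  have "c k = (\<Sum>j<k. of_real (\<alpha> (k - j)) * e j) + (\<Sum>j<k. of_real (\<alpha> (k - j))) * (\<i> * \<theta> * \<mu>)"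
    unfolding c_eq e_def by (simp add: algebra_simps sum_distrib_left sum_subtractf)
  also have "(\<Sum>j<k. of_real (\<alpha> (k - j)) :: complex) = of_real (a - T k)"
    by (simp flip: of_real_sum add: sum_reflect_convolution_kernel partial_sums[symmetric])
  finally show ?thesis by (simp add: d_def b_def algebra_simps)
qed

lemma d_norm_le: "norm (d k) \<le> (\<Sum>j<k. \<alpha> (k - j) * norm (e j)) + \<bar>\<theta>\<bar> * \<mu> * T k"
proof -
  have "norm (d k) \<le> norm (\<Sum>j<k. of_real (\<alpha> (k - j)) * e j) + norm (\<i> * \<theta> * \<mu> * T k)"
    unfolding d_eq by (rule norm_triangle_ineq4)
  also have "norm (\<Sum>j<k. of_real (\<alpha> (k - j)) * e j) \<le> (\<Sum>j<k. \<alpha> (k - j) * norm (e j))"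
    by (rule sum_norm_le) (simp add: norm_mult kernel_nonneg)
  also have "norm (\<i> * \<theta> * \<mu> * T k) = \<bar>\<theta>\<bar> * \<mu> * T k"
    using \<mu>_pos tail_nonneg by (simp add: norm_mult)
  finally show ?thesis by simp
qed

lemma e_norm_le: "norm (e k) \<le> m * norm (d k) + (2 + 2 * q * b\<^sup>2) * \<theta>\<^sup>2"
proof -
  have "e k = m * d k + (h k - (\<i> * \<theta> + m * c k))"
    unfolding e_def d_def b_eq[symmetric] by (simp add: algebra_simps)
  then have "norm (e k) \<le> norm (m * d k) + norm (h k - (\<i> * \<theta> + m * c k))"
    by (metis norm_triangle_ineq)
  also have "norm (h k - (\<i> * \<theta> + m * c k)) \<le> 2 * \<theta>\<^sup>2 + 2 * q * (b * \<bar>\<theta>\<bar>)\<^sup>2"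
    using h_lin[of k] mult_left_mono[OF power_mono[OF c_bound[of k], of 2] q_nonneg] by simp
  finally show ?thesis using m_nonneg by (simp add: norm_mult power_mult_distrib algebra_simps)
qed

lemma d_sum_le: "(\<Sum>k<t. norm (d k)) \<le> a * (\<Sum>k<t. norm (e k)) + \<bar>\<theta>\<bar> * \<mu> * S t"
proof -
  have "(\<Sum>k<t. norm (d k)) \<le> (\<Sum>k<t. \<Sum>j<k. \<alpha> (k - j) * norm (e j)) + (\<Sum>k<t. \<bar>\<theta>\<bar> * \<mu> * T k)"
    unfolding sum.distrib[symmetric] by (intro sum_mono d_norm_le)
  also have "(\<Sum>k<t. \<Sum>j<k. \<alpha> (k - j) * norm (e j)) \<le> a * (\<Sum>k<t. norm (e k))"
    by (rule convolution_sum_le) simp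
  finally show ?thesis by (simp add: S_def sum_distrib_left)
qed

text \<open>Combining \<open>d_sum_le\<close> with the summed \<open>e_norm_le\<close> bounds the
  sum of \<open>norm (d k)\<close> by \<open>a * m\<close> times itself plus sources. Since
  \<open>a * m < 1\<close>, it is absorbed on the left, and multiplication by \<mu> removes the
  factor \<open>1 - a * m\<close>.\<close>

lemma d_sum_bound: "(\<Sum>k<t. norm (d k)) \<le> \<mu>\<^sup>2 * \<bar>\<theta>\<bar> * S t + b * (2 + 2 * q * b\<^sup>2) * \<theta>\<^sup>2 * t"
proof -
  define D where "D = (\<Sum>k<t. norm (d k))"
  define E where "E = (\<Sum>k<t. norm (e k))"
  have "E \<le> (\<Sum>k<t. m * norm (d k) + (2 + 2 * q * b\<^sup>2) * \<theta>\<^sup>2)"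
    unfolding E_def by (intro sum_mono e_norm_le)
  then have "E \<le> m * D + (2 + 2 * q * b\<^sup>2) * \<theta>\<^sup>2 * t"
    by (simp add: sum.distrib D_def sum_distrib_left mult_ac)
  from mult_left_mono[OF this a_nonneg] have "(1 - a * m) * D \<le> \<bar>\<theta>\<bar> * \<mu> * S t + a * ((2 + 2 * q * b\<^sup>2) * \<theta>\<^sup>2 * t)"
    using d_sum_le[of t] by (simp add: D_def E_def algebra_simps)
  from mult_left_mono[OF this, of \<mu>] \<mu>_pos
  have "((1 - a * m) * \<mu>) * D \<le> \<mu> * (\<bar>\<theta>\<bar> * \<mu> * S t + a * ((2 + 2 * q * b\<^sup>2) * \<theta>\<^sup>2 * t))"
    by (simp add: mult_ac)
  then show ?thesis unfolding \<mu>_mult D_def by (simp add: b_def algebra_simps power2_eq_square)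
qed

text \<open>The second moment of \<open>\<i> * \<theta> + z * l\<close> when \<open>l\<close> has
  first two moments \<open>m\<close> and \<open>q\<close>.\<close>

definition "Q z = - (\<theta>\<^sup>2) + 2 * \<i> * \<theta> * m * z + q * z\<^sup>2" for z :: complex

text \<open>Both arguments are of order \<theta>, so factoring the difference of squares gains one
  power of \<theta> over \<open>d k\<close>.\<close>

lemma Q_diff_le: "norm (Q (c k) - Q (\<i> * \<theta> * b)) \<le> 2 * (m + q * b) * \<bar>\<theta>\<bar> * norm (d k)"
proof -
  have "Q (c k) - Q (\<i> * \<theta> * b) = (2 * \<i> * \<theta> * m + q * (c k + \<i> * \<theta> * b)) * d k"
    by (simp add: Q_def d_def power2_eq_square algebra_simps)
  moreover have "norm (2 * \<i> * \<theta> * m + q * (c k + \<i> * \<theta> * b)) \<le> 2 * \<bar>\<theta>\<bar> * m + q * (b * \<bar>\<theta>\<bar> + \<bar>\<theta>\<bar> * b)"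
  proof (intro norm_triangle_le add_mono)
    show "norm (2 * \<i> * complex_of_real \<theta> * complex_of_real m) \<le> 2 * \<bar>\<theta>\<bar> * m"
      using m_nonneg by (simp add: norm_mult)
    have "norm (c k + \<i> * \<theta> * b) \<le> b * \<bar>\<theta>\<bar> + \<bar>\<theta>\<bar> * b"
      using c_bound b_nonneg by (intro norm_triangle_le add_mono) (auto simp: norm_mult)
    then show "norm (q * (c k + \<i> * \<theta> * b)) \<le> q * (b * \<bar>\<theta>\<bar> + \<bar>\<theta>\<bar> * b)"
      using q_nonneg by (auto simp: norm_mult intro!: mult_left_mono)
  qed
  ultimately have "norm (Q (c k) - Q (\<i> * \<theta> * b)) \<le> (2 * \<bar>\<theta>\<bar> * m + q * (b * \<bar>\<theta>\<bar> + \<bar>\<theta>\<bar> * b)) * norm (d k)"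
    by (simp add: norm_mult mult_right_mono)
  then show ?thesis by (simp add: algebra_simps)
qed

text \<open>Up to a boundary term, summing turns the convolution into multiplication by
  \<open>a\<close>, so the summed expansion becomes a linear equation for the sum of
  \<open>h\<close>.\<close>

lemma sum_c: "(\<Sum>k<t. c k) = a * (\<Sum>k<t. h k) - (\<Sum>j<t. of_real (T (t - Suc j)) * h j)"
proof -
  have "(\<Sum>k<t. c k) = (\<Sum>j<t. of_real (a - T (t - Suc j)) * h j)"
    unfolding c_eq sum_triangle_convolution[of "\<lambda>i. complex_of_real (\<alpha> i)"]
    by (simp only: of_real_sum[symmetric] partial_sums)
  then show ?thesis by (simp add: algebra_simps sum_subtractf sum_distrib_left)
qed

text \<open>Sum the quadratic expansion, insert \<open>sum_c\<close> and move the multiple of the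
  sum of \<open>h\<close> to the left. The errors are the boundary term \<open>R\<close>, the cost
  \<open>V\<close> of evaluating \<open>Q\<close> at the constant solution, and the cubic
  remainders. If \<open>\<theta>\<^sup>2 * t\<close> stays bounded while \<theta> and
  \<open>\<bar>\<theta>\<bar> * S t\<close> tend to 0, all three vanish.\<close>

lemma sum_expansion:
  "norm ((1 - a * m) * (\<Sum>k<t. h k) - (\<i> * \<theta> * t - of_real (t * (\<theta>\<^sup>2 * (1 + 2 * m * b + q * b\<^sup>2)) / 2)))
    \<le> m * \<mu> * \<bar>\<theta>\<bar> * S t
      + (m + q * b) * \<bar>\<theta>\<bar> * (\<mu>\<^sup>2 * \<bar>\<theta>\<bar> * S t + b * (2 + 2 * q * b\<^sup>2) * \<theta>\<^sup>2 * t)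
      + K * (1 + b ^ 3) * \<bar>\<theta>\<bar> ^ 3 * t"
proof -
  define W where "W = \<theta>\<^sup>2 * (1 + 2 * m * b + q * b\<^sup>2)"
  define \<rho> where "\<rho> k = h k - (\<i> * \<theta> + m * c k) - Q (c k) / 2" for k
  define R where "R = (\<Sum>j<t. of_real (T (t - Suc j)) * h j)"
  define V where "V = (\<Sum>k<t. (Q (c k) - Q (\<i> * \<theta> * b)) / 2)"
  have hk: "h k = \<i> * \<theta> + m * c k + Q (c k) / 2 + \<rho> k" for k by (simp add: \<rho>_def)
  have "(\<Sum>k<t. h k) = (\<Sum>k<t. (\<i> * \<theta> + m * c k + (Q (c k) - Q (\<i> * \<theta> * b)) / 2 + \<rho> k + Q (\<i> * \<theta> * b) / 2))"
    by (rule sum.cong[OF refl], subst hk) (simp add: field_simps)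
  also have "\<dots> = t * (\<i> * \<theta>) + m * (\<Sum>k<t. c k) + V + (\<Sum>k<t. \<rho> k) + t * (Q (\<i> * \<theta> * b) / 2)"
    by (simp add: sum.distrib V_def flip: sum_distrib_left)
  finally have "(\<Sum>k<t. h k) = t * (\<i> * \<theta>) + m * (a * (\<Sum>k<t. h k) - R) + V + (\<Sum>k<t. \<rho> k) + t * (Q (\<i> * \<theta> * b) / 2)"
    unfolding sum_c R_def .
  \<comment> \<open>At the constant solution every term carries the square of the imaginary unit, so
    the value is real. It becomes the Gaussian exponent.\<close>
  moreover have "Q (\<i> * \<theta> * b) = - of_real W"
    unfolding W_def by (simp add: Q_def power2_eq_square algebra_simps)
  ultimately have "(1 - a * m) * (\<Sum>k<t. h k) - (\<i> * \<theta> * t - of_real (t * W / 2)) = (V + (\<Sum>k<t. \<rho> k)) - m * R"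
    by (simp add: algebra_simps)
  then have "norm ((1 - a * m) * (\<Sum>k<t. h k) - (\<i> * \<theta> * t - of_real (t * (\<theta>\<^sup>2 * (1 + 2 * m * b + q * b\<^sup>2)) / 2)))
      \<le> (norm V + norm (\<Sum>k<t. \<rho> k)) + norm (m * R)"
    by (metis norm_triangle_ineq norm_triangle_le_diff add_right_mono W_def)
  moreover have "norm (m * R) \<le> m * (\<mu> * \<bar>\<theta>\<bar> * S t)"
  proof -
    have "norm R \<le> (\<Sum>j<t. T (t - Suc j) * (\<mu> * \<bar>\<theta>\<bar>))"
      unfolding R_def by (rule sum_norm_le) (auto simp: norm_mult tail_nonneg h_bound intro!: mult_left_mono)
    also have "\<dots> = S t * (\<mu> * \<bar>\<theta>\<bar>)"
      unfolding S_def sum.nat_diff_reindex[of T t, symmetric] by (simp add: sum_distrib_right)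
    finally show ?thesis using m_nonneg by (simp add: norm_mult mult_left_mono mult_ac)
  qed
  moreover have "norm (\<Sum>k<t. \<rho> k) \<le> K * (1 + b ^ 3) * \<bar>\<theta>\<bar> ^ 3 * t"
  proof -
    have "norm (\<rho> k) \<le> K * (1 + b ^ 3) * \<bar>\<theta>\<bar> ^ 3" for k
    proof -
      have "norm (\<rho> k) \<le> K * (\<bar>\<theta>\<bar> ^ 3 + norm (c k) ^ 3)"
        using h_quad[of k] by (simp add: \<rho>_def Q_def)
      also have "\<dots> \<le> K * (\<bar>\<theta>\<bar> ^ 3 + (b * \<bar>\<theta>\<bar>) ^ 3)"
        using K_nonneg c_bound by (intro mult_left_mono add_left_mono power_mono) auto
      finally show ?thesis by (simp add: algebra_simps)
    qed
    then have "norm (\<Sum>k<t. \<rho> k) \<le> (\<Sum>k<t. K * (1 + b ^ 3) * \<bar>\<theta>\<bar> ^ 3)"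
      by (intro sum_norm_le)
    then show ?thesis by (simp add: mult_ac)
  qed
  moreover have "norm V \<le> (m + q * b) * \<bar>\<theta>\<bar> * (\<mu>\<^sup>2 * \<bar>\<theta>\<bar> * S t + b * (2 + 2 * q * b\<^sup>2) * \<theta>\<^sup>2 * t)"
  proof -
    have "norm V \<le> (\<Sum>k<t. (m + q * b) * \<bar>\<theta>\<bar> * norm (d k))"
      unfolding V_def
    proof (rule sum_norm_le)
      fix k show "norm ((Q (c k) - Q (\<i> * \<theta> * b)) / 2) \<le> (m + q * b) * \<bar>\<theta>\<bar> * norm (d k)"
        using Q_diff_le[of k] by (simp add: norm_divide algebra_simps)
    qed
    also have "\<dots> = (m + q * b) * \<bar>\<theta>\<bar> * (\<Sum>k<t. norm (d k))" by (simp add: sum_distrib_left)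
    also have "\<dots> \<le> (m + q * b) * \<bar>\<theta>\<bar> * (\<mu>\<^sup>2 * \<bar>\<theta>\<bar> * S t + b * (2 + 2 * q * b\<^sup>2) * \<theta>\<^sup>2 * t)"
      using m_nonneg q_nonneg b_nonneg by (intro mult_left_mono d_sum_bound) auto
    finally show ?thesis .
  qed
  ultimately show ?thesis by (simp add: mult.assoc)
qed

end

section \<open>Nonlinear Volterra recursions\<close>

fun volterra :: "(complex \<Rightarrow> complex) \<Rightarrow> (nat \<Rightarrow> real) \<Rightarrow> nat \<Rightarrow> complex" where
  "volterra F \<alpha> k = F (\<Sum>j<k. of_real (\<alpha> (k - j)) * volterra F \<alpha> j)"

declare volterra.simps [simp del]

text \<open>A sum with nonnegative weights of points in the closed left half-plane stays there, so
  the half-plane is invariant under the recursion.\<close>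

lemma Re_volterra_nonpos:
  assumes "\<And>z. Re z \<le> 0 \<Longrightarrow> Re (F z) \<le> 0" "\<And>i. 0 \<le> \<alpha> i"
  shows "Re (volterra F \<alpha> k) \<le> 0"
proof (induction k rule: less_induct)
  case (less k)
  then show ?case unfolding volterra.simps[of F \<alpha> k]
    by (intro assms(1)) (auto intro!: sum_nonpos mult_nonneg_nonpos assms(2))
qed

section \<open>The characteristic function of the counting process\<close>

text \<open>The closed left half-plane is convex, contains 0, and all derivatives of
  \<open>exp\<close> are bounded by 1 on it. Hence the constant does not depend on
  \<open>z\<close>.\<close>

lemma norm_exp_diff_taylor_le:
  fixes z :: complex
  assumes "Re z \<le> 0"
  shows "norm (exp z - (\<Sum>i\<le>n. z ^ i / fact i)) \<le> norm z ^ Suc n / fact n"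
proof -
  have "norm (exp z - (\<Sum>i\<le>n. exp 0 * (z - 0) ^ i / fact i)) \<le> 1 * norm (z - 0) ^ Suc n / fact n"
    by (rule complex_Taylor[of "{z. Re z \<le> 0}" n "\<lambda>_. exp" 1])
       (use assms in \<open>auto simp: convex_halfspace_Re_le intro: DERIV_subset[OF DERIV_exp]\<close>)
  then show ?thesis by simp
qed

text \<open>Dominated convergence for the partial sums. It serves to sum over the possible values of
  \<open>Z t\<close>.\<close>

lemma sums_integral_bounded_partial_sums:
  fixes f :: "nat \<Rightarrow> 'a \<Rightarrow> 'b::{banach, second_countable_topology}"
  assumes "finite_measure M" and [measurable]: "\<And>k. f k \<in> borel_measurable M" "F \<in> borel_measurable M"
    and sums: "AE x in M. (\<lambda>k. f k x) sums F x"
    and bound: "\<And>n. AE x in M. norm (\<Sum>k<n. f k x) \<le> B"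
  shows "(\<lambda>k. \<integral>x. f k x \<partial>M) sums (\<integral>x. F x \<partial>M)"
proof -
  interpret finite_measure M by fact
  have int: "integrable M (f k)" for k
  \<comment> \<open>A single term is the difference of two consecutive partial sums, each bounded by
    \<open>B\<close>.\<close>
  proof (rule integrable_const_bound[where B="B + B"])
    show "AE x in M. norm (f k x) \<le> B + B"
      using bound[of k] bound[of "Suc k"]
    proof eventually_elim
      case (elim x)
      have "f k x = (\<Sum>k<Suc k. f k x) - (\<Sum>k<k. f k x)" by simp
      with elim show ?case by (metis add_mono norm_triangle_ineq4 order_trans)
    qed
  qed simp
  have "(\<lambda>n. \<integral>x. (\<Sum>k<n. f k x) \<partial>M) \<longlonglongrightarrow> (\<integral>x. F x \<partial>M)"
    by (rule integral_dominated_convergence[where w="\<lambda>_. B"])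
       (use sums bound in \<open>auto simp: sums_def\<close>)
  then show ?thesis using int by (simp add: sums_def)
qed

text \<open>Stated without \<open>poisson_pmf\<close>, which is unspecified at nonpositive rates; on a null set the
  intensity may be nonpositive.\<close>

lemma poisson_pgf_sums:
  fixes z :: complex
  shows "(\<lambda>k. of_real (r ^ k / fact k * exp (- r)) * z ^ k) sums exp (of_real r * (z - 1))"
proof -
  have "(\<lambda>k. exp (- of_real r) * ((of_real r * z) ^ k /\<^sub>R fact k)) sums (exp (- of_real r) * exp (of_real r * z))"
    by (intro sums_mult exp_converges)
  moreover have "exp (- of_real r) * exp (of_real r * z) = exp (of_real r * (z - 1))"
    by (simp add: mult_exp_exp algebra_simps)
  moreover have "exp (- of_real r) * ((of_real r * z) ^ k /\<^sub>R fact k) = of_real (r ^ k / fact k * exp (- r)) * z ^ k" for k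
    by (simp add: scaleR_conv_of_real divide_inverse power_mult_distrib mult_ac exp_of_real[symmetric] flip: of_real_minus)
  ultimately show ?thesis by simp
qed

lemma sum_pmf_le_1: "finite A \<Longrightarrow> (\<Sum>k\<in>A. pmf p k) \<le> 1"
  by (metis measure_measure_pmf_finite measure_pmf.prob_le_1)

section \<open>Sigma-algebras generated by families of random variables\<close>

lemma sigma_gen_eq_sets:
  "sigma_gen M I N Y \<subseteq> Pow (space M)"
  "sigma_sets (space M) (sigma_gen M I N Y) = sigma_gen M I N Y"
proof -
  have "(\<Union>i\<in>I. {Y i -` A \<inter> space M | A. A \<in> sets N}) \<subseteq> Pow (space M)" by auto
  then show "sigma_gen M I N Y \<subseteq> Pow (space M)"
    unfolding sigma_gen_def using sigma_sets_into_sp by blast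
  show "sigma_sets (space M) (sigma_gen M I N Y) = sigma_gen M I N Y"
    unfolding sigma_gen_def by (rule sigma_sets_sigma_sets_eq) auto
qed

lemma sigma_gen_subset_events:
  assumes "\<And>i. i \<in> I \<Longrightarrow> Y i \<in> measurable M N"
  shows "sigma_gen M I N Y \<subseteq> sets M"
  unfolding sigma_gen_def using assms by (intro sets.sigma_sets_subset) (auto intro: measurable_sets)

text \<open>\<open>G\<close> is any space on \<open>space M\<close> that contains the generated
  sets, so that the same lemma serves the past, the past enlarged by \<open>Z t\<close>, and the
  marks at one time.\<close>

lemma measurable_sigma_gen:
  assumes "i \<in> I" "Y i \<in> measurable M N" "sigma_gen M I N Y \<subseteq> sets G" "space G = space M"
  shows "Y i \<in> measurable G N"
proof (rule measurableI)
  show "Y i x \<in> space N" if "x \<in> space G" for x using that assms(2,4) by (auto dest: measurable_space)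
  fix A assume "A \<in> sets N"
  then have "Y i -` A \<inter> space M \<in> sigma_gen M I N Y"
    unfolding sigma_gen_def using assms(1) by (intro sigma_sets.Basic) auto
  then show "Y i -` A \<inter> space G \<in> sets G" using assms(3,4) by auto
qed

section \<open>The natural filtration and the conditional law of the counts\<close>

context marked_hawkes
begin

abbreviation X where "X \<equiv> mark_sum l Z"
abbreviation hist where "hist t \<equiv> past M Z X t"

lemma mark_rv: "1 \<le> t \<Longrightarrow> 1 \<le> j \<Longrightarrow> random_variable borel (l t j)"
  using marks_indep unfolding indep_vars_def by force

lemma mark_sum_rv: "X t \<in> borel_measurable M"
proof (cases "t = 0")
  case False
  then have [measurable]: "\<And>j. 1 \<le> j \<Longrightarrow> l t j \<in> borel_measurable M" "Z t \<in> measurable M (count_space UNIV)"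
    using mark_rv counts_measurable by auto
  \<comment> \<open>The number of summands is random but takes countably many values.\<close>
  have "(\<lambda>\<omega>. (\<lambda>n \<omega>. \<Sum>j=1..n. l t j \<omega>) (Z t \<omega>) \<omega>) \<in> borel_measurable M"
    by (rule measurable_compose_countable) auto
  then show ?thesis using False by (simp add: mark_sum_def[abs_def])
qed (simp add: mark_sum_def[abs_def])

lemma past_sets_subset: "past_sets M Z X t \<subseteq> events"
  unfolding past_sets_def
  by (intro sets.sigma_sets_subset Un_least sigma_gen_subset_events)
     (auto intro: counts_measurable mark_sum_rv)

lemma space_hist: "space (hist t) = space M"
proof -
  have "past_sets M Z X t \<subseteq> Pow (space M)"
    using past_sets_subset sets.space_closed by blast
  then show ?thesis by (simp add: past_def)
qed

lemma sets_hist: "sets (hist t) = past_sets M Z X t"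
proof -
  have "past_sets M Z X t \<subseteq> Pow (space M)"
    using past_sets_subset sets.space_closed by blast
  moreover have "sigma_sets (space M) (past_sets M Z X t) = past_sets M Z X t"
    unfolding past_sets_def
    by (rule sigma_sets_sigma_sets_eq) (intro Un_least sigma_gen_eq_sets(1))
  ultimately show ?thesis by (simp add: past_def)
qed

lemma subalgebra_hist: "subalgebra M (hist t)"
  using past_sets_subset by (simp add: subalgebra_def space_hist sets_hist)

lemma count_hist_measurable: "1 \<le> s \<Longrightarrow> s \<le> t \<Longrightarrow> Z s \<in> measurable (hist t) (count_space UNIV)"
  by (rule measurable_sigma_gen[of s "{1..t}" Z M])
     (auto simp: counts_measurable space_hist sets_hist past_sets_def intro: sigma_sets.Basic)

lemma mark_sum_hist_measurable: "1 \<le> s \<Longrightarrow> s \<le> t \<Longrightarrow> X s \<in> borel_measurable (hist t)"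
  by (rule measurable_sigma_gen[of s "{1..t}" X M])
     (auto simp: mark_sum_rv space_hist sets_hist past_sets_def intro: sigma_sets.Basic)

lemma intensity_hist_measurable: "intensity \<nu> \<alpha> X t \<in> borel_measurable (hist (t - 1))"
proof -
  have "X (t - s) \<in> borel_measurable (hist (t - 1))" if "s \<in> {1..t - 1}" for s
    using that by (intro mark_sum_hist_measurable) auto
  then show ?thesis unfolding intensity_def[abs_def] by measurable
qed

text \<open>One null set serves all times, because an intensity involves all earlier values of
  \<open>X\<close>.\<close>

lemma AE_mark_sum_nonneg: "AE \<omega> in M. \<forall>t. 0 \<le> X t \<omega>"
proof -
  have "AE \<omega> in M. \<forall>t j. 1 \<le> t \<longrightarrow> 1 \<le> j \<longrightarrow> 0 < l t j \<omega>"
    unfolding AE_all_countable using marks_pos by auto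
  then show ?thesis
    by eventually_elim (auto simp: mark_sum_def intro!: sum_nonneg intro: less_imp_le)
qed

lemma AE_intensity_pos: "AE \<omega> in M. 0 < intensity \<nu> \<alpha> X t \<omega>"
  using AE_mark_sum_nonneg
proof eventually_elim
  case (elim \<omega>)
  then have "0 \<le> (\<Sum>s = 1..t - 1. \<alpha> s * X (t - s) \<omega>)"
    using exciting_pos by (intro sum_nonneg mult_nonneg_nonneg) (auto intro: less_imp_le)
  then show ?case using base_pos by (simp add: intensity_def)
qed

text \<open>The conditional law, tested against a bounded complex function of the past. Almost
  surely the intensity is positive, and there the mass function of \<open>poisson_pmf\<close> is the
  explicit formula.\<close>

lemma integral_hist_count:
  fixes W :: "'a \<Rightarrow> complex"
  assumes t: "1 \<le> t" and W: "W \<in> borel_measurable (hist (t - 1))" and W1: "AE \<omega> in M. norm (W \<omega>) \<le> 1"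
  shows "(CLINT \<omega>|M. W \<omega> * indicator {\<omega> \<in> space M. Z t \<omega> = k} \<omega>)
       = (CLINT \<omega>|M. W \<omega> * of_real (intensity \<nu> \<alpha> X t \<omega> ^ k / fact k * exp (- intensity \<nu> \<alpha> X t \<omega>)))"
proof -
  interpret S: finite_measure_subalgebra M "hist (t - 1)"
    by unfold_locales (rule subalgebra_hist)
  define I where "I = (indicator {\<omega> \<in> space M. Z t \<omega> = k} :: 'a \<Rightarrow> real)"
  define C where "C = real_cond_exp M (hist (t - 1)) I"
  have [measurable]: "W \<in> borel_measurable M"
    using measurable_from_subalg[OF subalgebra_hist W] .
  have [measurable]: "Z t \<in> measurable M (count_space UNIV)" using t by (rule counts_measurable)
  have I_meas[measurable]: "I \<in> borel_measurable M" unfolding I_def by measurable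
  have I1: "norm (I \<omega>) \<le> 1" for \<omega> by (simp add: I_def indicator_def)
  have C_eq: "AE \<omega> in M. C \<omega> = pmf (poisson_pmf (intensity \<nu> \<alpha> X t \<omega>)) k"
    using counts_cond_poisson[OF t, of k] by (simp add: C_def I_def)
  have C_meas[measurable]: "C \<in> borel_measurable M"
    unfolding C_def by (rule borel_measurable_cond_exp2)
  have C1: "AE \<omega> in M. norm (C \<omega>) \<le> 1"
    using C_eq by eventually_elim (simp add: pmf_le_1)
  \<comment> \<open>\<open>real_cond_exp\<close> is real-valued, so the identity is proved for
    \<open>g = Re\<close> and \<open>g = Im\<close> separately. The bound on \<open>g\<close> makes
    the product integrable.\<close>
  have real_part: "(\<integral>\<omega>. g (W \<omega>) * I \<omega> \<partial>M) = (\<integral>\<omega>. g (W \<omega>) * C \<omega> \<partial>M)"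
    if g: "g \<in> borel_measurable borel" and g_le: "\<And>z. \<bar>g z\<bar> \<le> norm z" for g :: "complex \<Rightarrow> real"
  proof -
    have gW: "(\<lambda>\<omega>. g (W \<omega>)) \<in> borel_measurable (hist (t - 1))"
      using measurable_compose[OF W g] .
    have [measurable]: "(\<lambda>\<omega>. g (W \<omega>)) \<in> borel_measurable M"
      using measurable_from_subalg[OF subalgebra_hist gW] .
    have "integrable M (\<lambda>\<omega>. g (W \<omega>) * I \<omega>)"
    proof (rule integrable_const_bound[where B="1"])
      show "AE \<omega> in M. norm (g (W \<omega>) * I \<omega>) \<le> 1"
        using W1
      proof eventually_elim
        case (elim \<omega>)
        then show ?case using mult_mono[of "\<bar>g (W \<omega>)\<bar>" 1 "\<bar>I \<omega>\<bar>" 1] I1[of \<omega>] g_le[of "W \<omega>"]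
          by (simp add: abs_mult)
      qed
    qed measurable
    then show ?thesis
      unfolding C_def using S.real_cond_exp_intg(2)[OF _ gW I_meas] by simp
  qed
  have int: "integrable M (\<lambda>\<omega>. W \<omega> * of_real (Y \<omega>))"
    if "Y \<in> borel_measurable M" "AE \<omega> in M. norm (Y \<omega>) \<le> 1" for Y :: "'a \<Rightarrow> real"
  proof (rule integrable_const_bound[where B="1"])
    show "AE \<omega> in M. norm (W \<omega> * of_real (Y \<omega>)) \<le> 1"
      using W1 that(2) by eventually_elim (simp add: norm_mult mult_le_one)
  qed (use that(1) in measurable)
  have "(CLINT \<omega>|M. W \<omega> * of_real (I \<omega>)) = (CLINT \<omega>|M. W \<omega> * of_real (C \<omega>))"
  proof (rule complex_eqI)
    show "Re (CLINT \<omega>|M. W \<omega> * of_real (I \<omega>)) = Re (CLINT \<omega>|M. W \<omega> * of_real (C \<omega>))"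
      using int[OF I_meas] int[OF C_meas C1] I1 real_part[of Re] abs_Re_le_cmod
      by (subst (1 2) integral_Re[symmetric]) auto
    show "Im (CLINT \<omega>|M. W \<omega> * of_real (I \<omega>)) = Im (CLINT \<omega>|M. W \<omega> * of_real (C \<omega>))"
      using int[OF I_meas] int[OF C_meas C1] I1 real_part[of Im] abs_Im_le_cmod
      by (subst (1 2) integral_Im[symmetric]) auto
  qed
  also have "\<dots> = (CLINT \<omega>|M. W \<omega> * of_real (intensity \<nu> \<alpha> X t \<omega> ^ k / fact k * exp (- intensity \<nu> \<alpha> X t \<omega>)))"
  proof (rule integral_cong_AE)
    show "AE \<omega> in M. W \<omega> * of_real (C \<omega>) = W \<omega> * of_real (intensity \<nu> \<alpha> X t \<omega> ^ k / fact k * exp (- intensity \<nu> \<alpha> X t \<omega>))"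
      using C_eq AE_intensity_pos[of t] by eventually_elim simp
    have [measurable]: "intensity \<nu> \<alpha> X t \<in> borel_measurable M"
      using measurable_from_subalg[OF subalgebra_hist intensity_hist_measurable] .
    show "(\<lambda>\<omega>. W \<omega> * of_real (intensity \<nu> \<alpha> X t \<omega> ^ k / fact k * exp (- intensity \<nu> \<alpha> X t \<omega>))) \<in> borel_measurable M"
      by measurable
  qed measurable
  also have "(\<lambda>\<omega>. complex_of_real (I \<omega>)) = indicator {\<omega> \<in> space M. Z t \<omega> = k}"
    by (auto simp: I_def indicator_def)
  finally show ?thesis .
qed


section \<open>Transform of a single event, counting the event itself and its mark\<close>

definition mark_pgf :: "real \<Rightarrow> complex \<Rightarrow> complex" where
  "mark_pgf \<theta> c = (CLINT \<omega>|M. exp (\<i> * \<theta> + c * l 1 1 \<omega>))"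

lemma mark_pgf_eq:
  fixes \<theta> :: real and c :: complex
  assumes "1 \<le> t" "1 \<le> j"
  shows "(CLINT \<omega>|M. exp (\<i> * \<theta> + c * l t j \<omega>)) = mark_pgf \<theta> c"
proof -
  have "(CLINT \<omega>|M. exp (\<i> * \<theta> + c * l t j \<omega>)) = (CLINT x|distr M borel (l t j). exp (\<i> * \<theta> + c * x))"
    if "1 \<le> t" "1 \<le> j" for t j
    using mark_rv[OF that] by (simp add: integral_distr)
  then show ?thesis using assms marks_distr[OF assms] by (simp add: mark_pgf_def)
qed

lemma norm_exp_mark_le:
  fixes \<theta> :: real and c :: complex
  assumes "Re c \<le> 0" "1 \<le> t" "1 \<le> j"
  shows "AE \<omega> in M. norm (exp (\<i> * \<theta> + c * l t j \<omega>)) \<le> 1"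
  using marks_pos[OF assms(2,3)]
  by eventually_elim (use assms(1) in \<open>simp add: mult_nonpos_nonneg\<close>)

lemma integrable_exp_mark:
  fixes \<theta> :: real and c :: complex
  assumes "Re c \<le> 0" "1 \<le> t" "1 \<le> j"
  shows "integrable M (\<lambda>\<omega>. exp (\<i> * \<theta> + c * l t j \<omega>))"
proof -
  note [measurable] = mark_rv[OF assms(2,3)]
  show ?thesis by (rule integrable_const_bound[OF norm_exp_mark_le[OF assms]]) measurable
qed

lemma norm_mark_pgf_le:
  fixes \<theta> :: real and c :: complex
  assumes "Re c \<le> 0"
  shows "norm (mark_pgf \<theta> c) \<le> 1"
proof -
  have "norm (mark_pgf \<theta> c) \<le> (\<integral>\<omega>. norm (exp (\<i> * \<theta> + c * l 1 1 \<omega>)) \<partial>M)"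
    unfolding mark_pgf_def by (rule integral_norm_bound)
  also have "\<dots> \<le> (\<integral>\<omega>. 1 \<partial>M)"
    using norm_exp_mark_le[OF assms, of 1 1 \<theta>] integrable_exp_mark[OF assms, of 1 1 \<theta>]
    by (intro integral_mono_AE integrable_norm) auto
  finally show ?thesis by (simp add: prob_space)
qed

lemma integral_exp_mark_prod:
  fixes \<theta> :: real and c :: complex
  assumes c: "Re c \<le> 0" and t: "1 \<le> t"
  shows "(CLINT \<omega>|M. \<Prod>j=1..n. exp (\<i> * \<theta> + c * l t j \<omega>)) = mark_pgf \<theta> c ^ n"
    and "integrable M (\<lambda>\<omega>. \<Prod>j=1..n. exp (\<i> * \<theta> + c * l t j \<omega>))"
proof -
  let ?f = "\<lambda>p \<omega>. exp (\<i> * \<theta> + c * (case p of (t, j) \<Rightarrow> l t j) \<omega>)"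
  \<comment> \<open>\<open>marks_indep\<close> is indexed by pairs, so the product over
    \<open>j\<close> is rewritten as one over pairs with first component \<open>t\<close>.\<close>
  have "indep_vars (\<lambda>_. borel) (\<lambda>p. case p of (t, j) \<Rightarrow> l t j) ({t} \<times> {1..n})"
    using t by (intro indep_vars_subset[OF marks_indep]) auto
  then have ind: "indep_vars (\<lambda>_. borel) ?f ({t} \<times> {1..n})"
    by (rule indep_vars_compose2) measurable
  have int: "integrable M (?f p)" if "p \<in> {t} \<times> {1..n}" for p
    using that t c by (auto intro!: integrable_exp_mark)
  have prod_eq: "(\<Prod>j=1..n. exp (\<i> * \<theta> + c * l t j \<omega>)) = (\<Prod>p\<in>{t} \<times> {1..n}. ?f p \<omega>)" for \<omega>
    by (rule prod.reindex_bij_witness[of _ snd "\<lambda>j. (t, j)"]) auto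
  show "integrable M (\<lambda>\<omega>. \<Prod>j=1..n. exp (\<i> * \<theta> + c * l t j \<omega>))"
    unfolding prod_eq by (rule indep_vars_integrable[OF _ ind int]) auto
  have "(CLINT \<omega>|M. \<Prod>p\<in>{t} \<times> {1..n}. ?f p \<omega>) = (\<Prod>p\<in>{t} \<times> {1..n}. CLINT \<omega>|M. ?f p \<omega>)"
    by (rule indep_vars_lebesgue_integral[OF _ ind int]) auto
  also have "\<dots> = (\<Prod>p\<in>{t} \<times> {1..n}. mark_pgf \<theta> c)"
    using t by (intro prod.cong) (auto intro: mark_pgf_eq)
  finally show "(CLINT \<omega>|M. \<Prod>j=1..n. exp (\<i> * \<theta> + c * l t j \<omega>)) = mark_pgf \<theta> c ^ n"
    unfolding prod_eq by (simp add: card_cartesian_product)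
qed

text \<open>The information from which the marks at time \<open>t\<close> are independent; it
  contains \<open>Z t\<close> but is built without \<open>X t\<close>.\<close>

definition hist_count where
  "hist_count t = sigma (space M)
     (sigma_sets (space M) (past_sets M Z X (t - 1) \<union> sigma_gen M {t} (count_space UNIV) Z))"

lemma hist_count_basis: "past_sets M Z X (t - 1) \<union> sigma_gen M {t} (count_space UNIV) Z \<subseteq> Pow (space M)"
  using past_sets_subset[of "t - 1"] sets.space_closed[of M] sigma_gen_eq_sets(1)[of M "{t}"] by blast

lemma space_hist_count: "space (hist_count t) = space M"
  and sets_hist_count: "sets (hist_count t) =
     sigma_sets (space M) (past_sets M Z X (t - 1) \<union> sigma_gen M {t} (count_space UNIV) Z)"
proof -
  have "sigma_sets (space M) (past_sets M Z X (t - 1) \<union> sigma_gen M {t} (count_space UNIV) Z) \<subseteq> Pow (space M)"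
    using sigma_sets_into_sp[OF hist_count_basis] by blast
  then show "space (hist_count t) = space M"
    "sets (hist_count t) = sigma_sets (space M) (past_sets M Z X (t - 1) \<union> sigma_gen M {t} (count_space UNIV) Z)"
    unfolding hist_count_def by (simp_all add: sigma_sets_sigma_sets_eq[OF hist_count_basis] del: One_nat_def)
qed

text \<open>The sets generated by \<open>f\<close> and by \<open>g\<close> lie in the two
  independent sigma-algebras of \<open>marks_indep_past\<close>, and independence passes to
  subfamilies.\<close>

lemma indep_var_marks_hist_count:
  assumes t: "1 \<le> t"
    and f: "f \<in> measurable (sigma (space M) (sigma_gen M {1..} borel (l t))) N"
    and g: "g \<in> measurable (hist_count t) N'"
  shows "indep_var N f N' g"
proof -
  define L where "L = sigma (space M) (sigma_gen M {1..} borel (l t))"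
  have L: "space L = space M" "sets L = sigma_gen M {1..} borel (l t)"
    using sigma_gen_eq_sets[of M "{1..}" borel "l t"] by (auto simp: L_def)
  have L_sub: "sets L \<subseteq> events"
    unfolding L using t by (intro sigma_gen_subset_events mark_rv) auto
  have H_sub: "sets (hist_count t) \<subseteq> events"
    unfolding sets_hist_count using t past_sets_subset
    by (intro sets.sigma_sets_subset Un_least sigma_gen_subset_events counts_measurable) auto
  have f': "f \<in> measurable M N" and g': "g \<in> measurable M N'"
    using f g L_sub H_sub L space_hist_count unfolding L_def[symmetric] measurable_def by auto
  have "sigma_sets (space M) {f -` A \<inter> space M | A. A \<in> sets N} \<subseteq> sigma_gen M {1..} borel (l t)"
    using measurable_sets[OF f] L unfolding L_def[symmetric]
    by (subst L(2)[symmetric], intro sets.sigma_sets_subset[of _ L, unfolded L(1)]) auto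
  moreover have "sigma_sets (space M) {g -` A \<inter> space M | A. A \<in> sets N'} \<subseteq>
      sigma_sets (space M) (past_sets M Z X (t - 1) \<union> sigma_gen M {t} (count_space UNIV) Z)"
    using measurable_sets[OF g]
    by (subst sets_hist_count[symmetric], intro sets.sigma_sets_subset[of _ "hist_count t", unfolded space_hist_count])
       (auto simp: space_hist_count)
  ultimately have "indep_sets (case_bool (sigma_sets (space M) {f -` A \<inter> space M | A. A \<in> sets N})
      (sigma_sets (space M) {g -` A \<inter> space M | A. A \<in> sets N'})) UNIV"
    by (intro indep_sets_mono_sets[OF marks_indep_past[OF t, unfolded indep_set_def]]) (simp split: bool.split)
  then show ?thesis
    unfolding indep_var_eq indep_set_def using f' g' by simp
qed

lemma hist_count_measurable:
  "f \<in> measurable (hist (t - 1)) N \<Longrightarrow> f \<in> measurable (hist_count t) N"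
  by (rule measurable_from_subalg[of "hist_count t" "hist (t - 1)"])
     (auto simp: subalgebra_def sets_hist_count sets_hist space_hist space_hist_count intro: sigma_sets.Basic)

lemma count_hist_count_measurable:
  assumes "1 \<le> t"
  shows "Z t \<in> measurable (hist_count t) (count_space UNIV)"
  by (rule measurable_sigma_gen[of t "{t}" Z M])
     (use assms in \<open>auto simp: counts_measurable space_hist_count sets_hist_count intro: sigma_sets.Basic\<close>)

lemma mark_gen_measurable:
  assumes "1 \<le> t" "1 \<le> j"
  shows "l t j \<in> borel_measurable (sigma (space M) (sigma_gen M {1..} borel (l t)))"
  by (rule measurable_sigma_gen[of j "{1..}" "l t" M])
     (use assms in \<open>auto simp: mark_rv sigma_gen_eq_sets\<close>)

lemma norm_exp_count_mark_sum_le: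
  fixes \<theta> :: real and c :: complex
  assumes "Re c \<le> 0"
  shows "AE \<omega> in M. norm (exp (\<i> * \<theta> * Z t \<omega> + c * X t \<omega>)) \<le> 1"
  using AE_mark_sum_nonneg
  by eventually_elim (use assms in \<open>simp add: mult_nonpos_nonneg\<close>)

text \<open>Where \<open>Z t\<close> equals \<open>k\<close>, the random sum has a fixed number of
  terms and the exponential is a product over \<open>k\<close> marks. This product is independent of
  the past and of \<open>Z t\<close>, so its mean \<open>mark_pgf \<theta> c ^ k\<close> factors
  out.\<close>

lemma integral_hist_count_mark_sum:
  fixes W :: "'a \<Rightarrow> complex" and \<theta> :: real and c :: complex
  assumes t: "1 \<le> t" and W: "W \<in> borel_measurable (hist (t - 1))"
    and W1: "AE \<omega> in M. norm (W \<omega>) \<le> 1" and c: "Re c \<le> 0"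
  shows "(CLINT \<omega>|M. W \<omega> * exp (\<i> * \<theta> * Z t \<omega> + c * X t \<omega>) * indicator {\<omega> \<in> space M. Z t \<omega> = k} \<omega>)
       = (CLINT \<omega>|M. W \<omega> * (of_real (intensity \<nu> \<alpha> X t \<omega> ^ k / fact k * exp (- intensity \<nu> \<alpha> X t \<omega>)) * mark_pgf \<theta> c ^ k))"
proof -
  let ?I = "indicator {\<omega> \<in> space M. Z t \<omega> = k} :: 'a \<Rightarrow> complex"
  let ?E = "\<lambda>\<omega>. \<Prod>j=1..k. exp (\<i> * \<theta> + c * l t j \<omega>)"
  have [measurable]: "W \<in> borel_measurable M"
    using measurable_from_subalg[OF subalgebra_hist W] .
  have [measurable]: "Z t \<in> measurable M (count_space UNIV)" using t by (rule counts_measurable)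
  have eq: "W \<omega> * exp (\<i> * \<theta> * Z t \<omega> + c * X t \<omega>) * ?I \<omega> = ?E \<omega> * (W \<omega> * ?I \<omega>)" for \<omega>
    using t by (auto simp: indicator_def mark_sum_def exp_sum[symmetric] sum.distrib sum_distrib_left mult_ac)
  have "(CLINT \<omega>|M. W \<omega> * exp (\<i> * \<theta> * Z t \<omega> + c * X t \<omega>) * ?I \<omega>) = (CLINT \<omega>|M. ?E \<omega> * (W \<omega> * ?I \<omega>))"
    by (simp only: eq)
  also have "\<dots> = (CLINT \<omega>|M. ?E \<omega>) * (CLINT \<omega>|M. W \<omega> * ?I \<omega>)"
  proof (rule indep_var_lebesgue_integral)
    have "l t j \<in> borel_measurable (sigma (space M) (sigma_gen M {1..} borel (l t)))" if "j \<in> {1..k}" for j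
      using that t by (intro mark_gen_measurable) auto
    then have E: "?E \<in> borel_measurable (sigma (space M) (sigma_gen M {1..} borel (l t)))"
      by measurable
    note [measurable] = hist_count_measurable[OF W] count_hist_count_measurable[OF t]
    have "(\<lambda>\<omega>. W \<omega> * indicator {\<omega> \<in> space (hist_count t). Z t \<omega> = k} \<omega>) \<in> borel_measurable (hist_count t)"
      by measurable
    then show "indep_var borel ?E borel (\<lambda>\<omega>. W \<omega> * ?I \<omega>)"
      unfolding space_hist_count by (rule indep_var_marks_hist_count[OF t E])
    show "integrable M ?E" by (rule integral_exp_mark_prod(2)[OF c t])
    show "integrable M (\<lambda>\<omega>. W \<omega> * ?I \<omega>)"
      by (rule integrable_const_bound[where B=1])
         (use W1 in \<open>eventually_elim, auto simp: indicator_def norm_mult\<close>, measurable)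
  qed
  also have "(CLINT \<omega>|M. ?E \<omega>) = mark_pgf \<theta> c ^ k"
    by (rule integral_exp_mark_prod(1)[OF c t])
  also have "mark_pgf \<theta> c ^ k * (CLINT \<omega>|M. W \<omega> * ?I \<omega>) = (CLINT \<omega>|M. mark_pgf \<theta> c ^ k
      * (W \<omega> * of_real (intensity \<nu> \<alpha> X t \<omega> ^ k / fact k * exp (- intensity \<nu> \<alpha> X t \<omega>))))"
    unfolding integral_hist_count[OF t W W1] by (simp only: integral_mult_right_zero)
  finally show ?thesis by (simp only: mult_ac)
qed

text \<open>One backward step: split by the value of \<open>Z t\<close>, evaluate each piece, and
  resum the Poisson series. Both series of integrals need partial sums bounded uniformly in
  \<open>n\<close>.\<close>

lemma integral_hist_step:
  fixes W :: "'a \<Rightarrow> complex" and \<theta> :: real and c :: complex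
  assumes t: "1 \<le> t" and W: "W \<in> borel_measurable (hist (t - 1))"
    and W1: "AE \<omega> in M. norm (W \<omega>) \<le> 1" and c: "Re c \<le> 0"
  shows "(CLINT \<omega>|M. W \<omega> * exp (\<i> * \<theta> * Z t \<omega> + c * X t \<omega>))
       = (CLINT \<omega>|M. W \<omega> * exp (intensity \<nu> \<alpha> X t \<omega> * (mark_pgf \<theta> c - 1)))"
proof -
  have [measurable]: "W \<in> borel_measurable M"
    using measurable_from_subalg[OF subalgebra_hist W] .
  have [measurable]: "Z t \<in> measurable M (count_space UNIV)" using t by (rule counts_measurable)
  have [measurable]: "intensity \<nu> \<alpha> X t \<in> borel_measurable M"
    using measurable_from_subalg[OF subalgebra_hist intensity_hist_measurable] .
  note [measurable] = mark_sum_rv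
  let ?U = "\<lambda>\<omega>. W \<omega> * exp (\<i> * \<theta> * Z t \<omega> + c * X t \<omega>)"
  let ?I = "\<lambda>k. indicator {\<omega> \<in> space M. Z t \<omega> = k} :: 'a \<Rightarrow> complex"
  let ?p = "\<lambda>k \<omega>. intensity \<nu> \<alpha> X t \<omega> ^ k / fact k * exp (- intensity \<nu> \<alpha> X t \<omega>)"
  have "(\<lambda>k. CLINT \<omega>|M. ?U \<omega> * ?I k \<omega>) sums (CLINT \<omega>|M. ?U \<omega>)"
  proof (rule sums_integral_bounded_partial_sums[where B=1])
    show "finite_measure M" by (rule finite_measure_axioms)
    show "AE \<omega> in M. (\<lambda>k. ?U \<omega> * ?I k \<omega>) sums ?U \<omega>"
    proof (rule AE_I2)
      fix \<omega> assume "\<omega> \<in> space M"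
      then have "?U \<omega> * ?I k \<omega> = (if k = Z t \<omega> then ?U \<omega> else 0)" for k
        by (auto simp: indicator_def)
      then show "(\<lambda>k. ?U \<omega> * ?I k \<omega>) sums ?U \<omega>"
        using sums_single[of "Z t \<omega>" "\<lambda>_. ?U \<omega>"] by simp
    qed
    fix n
    show "AE \<omega> in M. norm (\<Sum>k<n. ?U \<omega> * ?I k \<omega>) \<le> 1"
      using W1 norm_exp_count_mark_sum_le[OF c, of \<theta> t] AE_space
    proof eventually_elim
      case (elim \<omega>)
      \<comment> \<open>At most one indicator is nonzero, so a partial sum is either 0 or the whole
        integrand.\<close>
      then have "(\<Sum>k<n. ?U \<omega> * ?I k \<omega>) = (if Z t \<omega> < n then ?U \<omega> else 0)"
        by (simp add: indicator_def if_distrib sum.delta' cong: if_cong)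
      moreover have "norm (?U \<omega>) \<le> 1"
        using elim(1,2) unfolding norm_mult by (intro mult_le_one) auto
      ultimately show ?case by simp
    qed
  qed measurable
  moreover have "(\<lambda>k. CLINT \<omega>|M. W \<omega> * (of_real (?p k \<omega>) * mark_pgf \<theta> c ^ k))
      sums (CLINT \<omega>|M. W \<omega> * exp (intensity \<nu> \<alpha> X t \<omega> * (mark_pgf \<theta> c - 1)))"
  proof (rule sums_integral_bounded_partial_sums[where B=1])
    show "finite_measure M" by (rule finite_measure_axioms)
    show "AE \<omega> in M. (\<lambda>k. W \<omega> * (of_real (?p k \<omega>) * mark_pgf \<theta> c ^ k))
        sums (W \<omega> * exp (intensity \<nu> \<alpha> X t \<omega> * (mark_pgf \<theta> c - 1)))"
      by (intro AE_I2 sums_mult poisson_pgf_sums)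
    fix n
    show "AE \<omega> in M. norm (\<Sum>k<n. W \<omega> * (of_real (?p k \<omega>) * mark_pgf \<theta> c ^ k)) \<le> 1"
      using W1 AE_intensity_pos[of t]
    proof eventually_elim
      case (elim \<omega>)
      \<comment> \<open>Since \<open>W\<close> and \<open>mark_pgf\<close> have norm at most 1, only
        the Poisson weights remain, and these sum to at most 1.\<close>
      have "norm (\<Sum>k<n. W \<omega> * (of_real (?p k \<omega>) * mark_pgf \<theta> c ^ k)) \<le> (\<Sum>k<n. ?p k \<omega>)"
      proof (rule sum_norm_le)
        fix k
        have "norm (W \<omega>) * (\<bar>?p k \<omega>\<bar> * norm (mark_pgf \<theta> c) ^ k) \<le> 1 * (\<bar>?p k \<omega>\<bar> * 1)"
          using elim(1) norm_mark_pgf_le[OF c, of \<theta>]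
          by (intro mult_mono mult_left_mono power_le_one) auto
        then show "norm (W \<omega> * (of_real (?p k \<omega>) * mark_pgf \<theta> c ^ k)) \<le> ?p k \<omega>"
          using elim(2) by (simp add: norm_mult norm_power norm_divide)
      qed
      also have "\<dots> \<le> 1"
        using sum_pmf_le_1[of "{..<n}" "poisson_pmf (intensity \<nu> \<alpha> X t \<omega>)"] elim(2) by simp
      finally show ?case .
    qed
  qed measurable
  ultimately show ?thesis
    unfolding integral_hist_count_mark_sum[OF t W W1 c] by (rule sums_unique2)
qed

section \<open>Backward recursion for the characteristic function of the count\<close>

definition hawkes_coeff :: "real \<Rightarrow> nat \<Rightarrow> complex" where
  "hawkes_coeff \<theta> = volterra (\<lambda>z. mark_pgf \<theta> z - 1) \<alpha>"

definition hawkes_conv :: "real \<Rightarrow> nat \<Rightarrow> complex" where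
  "hawkes_conv \<theta> k = (\<Sum>j<k. of_real (\<alpha> (k - j)) * hawkes_coeff \<theta> j)"

lemma hawkes_coeff_eq: "hawkes_coeff \<theta> k = mark_pgf \<theta> (hawkes_conv \<theta> k) - 1"
  by (simp add: hawkes_coeff_def hawkes_conv_def volterra.simps[of _ _ k])

lemma Re_hawkes_coeff: "Re (hawkes_coeff \<theta> k) \<le> 0"
  unfolding hawkes_coeff_def
proof (rule Re_volterra_nonpos)
  fix z :: complex assume "Re z \<le> 0"
  then show "Re (mark_pgf \<theta> z - 1) \<le> 0"
    using norm_mark_pgf_le[of z \<theta>] complex_Re_le_cmod[of "mark_pgf \<theta> z"] by simp
qed (rule less_imp_le[OF exciting_pos])

lemma Re_hawkes_conv: "Re (hawkes_conv \<theta> k) \<le> 0"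
  unfolding hawkes_conv_def
  by (auto intro!: sum_nonpos mult_nonneg_nonpos Re_hawkes_coeff less_imp_le[OF exciting_pos])

text \<open>The exponent after integrating out the times \<open>t - r + 1, ..., t\<close>, with the contribution of
  times later than \<open>s\<close> dropped.\<close>

definition backward_exponent :: "real \<Rightarrow> nat \<Rightarrow> nat \<Rightarrow> nat \<Rightarrow> 'a \<Rightarrow> complex" where
  "backward_exponent \<theta> t r s \<omega> = \<i> * \<theta> * (\<Sum>u=1..s. Z u \<omega>)
     + (\<Sum>k<r. hawkes_coeff \<theta> k * of_real (\<nu> + (\<Sum>u=1..s. \<alpha> (t - k - u) * X u \<omega>)))"

lemma backward_exponent_hist_measurable:
  "backward_exponent \<theta> t r s \<in> borel_measurable (hist s)"
proof -
  have "(\<lambda>\<omega>. of_nat (Z u \<omega>) :: complex) \<in> borel_measurable (hist s)" "X u \<in> borel_measurable (hist s)" if "u \<in> {1..s}" for u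
    using that by (auto intro!: mark_sum_hist_measurable measurable_compose[OF count_hist_measurable])
  then show ?thesis unfolding backward_exponent_def[abs_def] of_nat_sum by measurable
qed

lemma norm_exp_backward_exponent_le: "AE \<omega> in M. norm (exp (backward_exponent \<theta> t r s \<omega>)) \<le> 1"
  using AE_mark_sum_nonneg
proof eventually_elim
  case (elim \<omega>)
  have "0 \<le> \<nu> + (\<Sum>u=1..s. \<alpha> (t - k - u) * X u \<omega>)" for k
    using elim base_pos by (intro add_nonneg_nonneg sum_nonneg mult_nonneg_nonneg less_imp_le[OF exciting_pos]) auto
  then have "(\<Sum>k<r. Re (hawkes_coeff \<theta> k) * (\<nu> + (\<Sum>u=1..s. \<alpha> (t - k - u) * X u \<omega>))) \<le> 0"
    by (intro sum_nonpos mult_nonpos_nonneg Re_hawkes_coeff)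
  then show ?case by (simp add: backward_exponent_def)
qed

text \<open>The intensity at time \<open>t - k\<close> weights \<open>X (t - r)\<close> by
  \<open>\<alpha> (r - k)\<close>. Summed against the coefficients with \<open>k < r\<close>, these
  weights give \<open>hawkes_conv \<theta> r\<close>.\<close>

lemma backward_exponent_split:
  assumes "r < t"
  shows "backward_exponent \<theta> t r (t - r) \<omega> = backward_exponent \<theta> t r (t - r - 1) \<omega>
    + (\<i> * \<theta> * Z (t - r) \<omega> + hawkes_conv \<theta> r * X (t - r) \<omega>)"
proof -
  obtain s where s: "t - r = Suc s" using assms by (metis Suc_diff_Suc)
  have conv: "(\<Sum>k<r. hawkes_coeff \<theta> k * of_real (\<alpha> (t - k - Suc s) * X (Suc s) \<omega>)) = hawkes_conv \<theta> r * X (Suc s) \<omega>"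
    unfolding hawkes_conv_def sum_distrib_right
  proof (rule sum.cong[OF refl])
    fix k assume "k \<in> {..<r}"
    then have "t - k - Suc s = r - k" using s assms by auto
    then show "hawkes_coeff \<theta> k * of_real (\<alpha> (t - k - Suc s) * X (Suc s) \<omega>) = of_real (\<alpha> (r - k)) * hawkes_coeff \<theta> k * X (Suc s) \<omega>"
      by simp
  qed
  show ?thesis
    unfolding s conv[symmetric]
    by (simp add: backward_exponent_def algebra_simps sum.distrib sum_distrib_left)
qed

text \<open>The new summand \<open>k = r\<close> is the coefficient times the intensity at time
  \<open>t - r\<close>, with the sum defining that intensity read in reverse order.\<close>

lemma backward_exponent_Suc:
  assumes "r < t"
  shows "backward_exponent \<theta> t (Suc r) (t - Suc r) \<omega> = backward_exponent \<theta> t r (t - r - 1) \<omega>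
    + intensity \<nu> \<alpha> X (t - r) \<omega> * (mark_pgf \<theta> (hawkes_conv \<theta> r) - 1)"
proof -
  have "(\<Sum>u=1..t - r - 1. \<alpha> (t - r - u) * X u \<omega>) = (\<Sum>s=1..t - r - 1. \<alpha> s * X (t - r - s) \<omega>)"
    by (rule sum.reindex_bij_witness[of _ "\<lambda>s. t - r - s" "\<lambda>s. t - r - s"]) auto
  then have "intensity \<nu> \<alpha> X (t - r) \<omega> = \<nu> + (\<Sum>u=1..t - Suc r. \<alpha> (t - r - u) * X u \<omega>)"
    by (simp add: intensity_def)
  then show ?thesis
    by (simp add: backward_exponent_def hawkes_coeff_eq[of \<theta> r] mult.commute)
qed

lemma integral_backward_exponent:
  "r \<le> t \<Longrightarrow> (CLINT \<omega>|M. exp (backward_exponent \<theta> t r (t - r) \<omega>)) = (CLINT \<omega>|M. exp (\<i> * \<theta> * count_upto Z t \<omega>))"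
proof (induction r)
  case 0
  show ?case by (simp add: backward_exponent_def count_upto_def)
next
  case (Suc r)
  \<comment> \<open>The factor that depends only on times before \<open>t - r\<close>; the rest is
    affine in \<open>Z\<close> and \<open>X\<close> at time \<open>t - r\<close>.\<close>
  define W where "W \<omega> = exp (backward_exponent \<theta> t r (t - r - 1) \<omega>)" for \<omega>
  have W: "W \<in> borel_measurable (hist (t - r - 1))"
    unfolding W_def[abs_def] using backward_exponent_hist_measurable by measurable
  have "(CLINT \<omega>|M. exp (backward_exponent \<theta> t r (t - r) \<omega>))
      = (CLINT \<omega>|M. W \<omega> * exp (\<i> * \<theta> * Z (t - r) \<omega> + hawkes_conv \<theta> r * X (t - r) \<omega>))"
    using Suc.prems by (simp add: backward_exponent_split exp_add W_def)
  also have "\<dots> = (CLINT \<omega>|M. W \<omega> * exp (intensity \<nu> \<alpha> X (t - r) \<omega> * (mark_pgf \<theta> (hawkes_conv \<theta> r) - 1)))"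
    using Suc.prems norm_exp_backward_exponent_le
    by (intro integral_hist_step W Re_hawkes_conv) (auto simp: W_def)
  also have "\<dots> = (CLINT \<omega>|M. exp (backward_exponent \<theta> t (Suc r) (t - Suc r) \<omega>))"
    using Suc.prems backward_exponent_Suc[of r t \<theta>] by (simp add: exp_add W_def)
  finally show ?case using Suc by simp
qed

text \<open>After \<open>t\<close> steps no earlier time is left and the exponent is
  deterministic.\<close>

theorem integral_exp_count:
  "(CLINT \<omega>|M. exp (\<i> * \<theta> * count_upto Z t \<omega>)) = exp (\<nu> * (\<Sum>k<t. hawkes_coeff \<theta> k))"
  using integral_backward_exponent[of t t \<theta>]
  by (simp add: backward_exponent_def sum_distrib_left prob_space mult_ac)

end

section \<open>Asymptotics\<close>

lemma real_distribution_normal: "0 < v \<Longrightarrow> real_distribution (normal_distribution \<mu> v)"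
  unfolding normal_distribution_def real_distribution_def real_distribution_axioms_def
  by (simp add: prob_space_normal_density)

lemma char_normal_distribution_0:
  assumes "0 < v"
  shows "char (normal_distribution 0 v) x = exp (- (v * x\<^sup>2) / 2)"
proof -
  interpret std: real_distribution std_normal_distribution by (rule real_dist_normal_dist)
  have "distributed std_normal_distribution lborel (\<lambda>x. x) std_normal_density"
    by (simp add: distributed_def distr_id2)
  from std.normal_density_affine[OF this, of "sqrt v" 0] assms
  have "distr std_normal_distribution lborel (\<lambda>x. sqrt v * x) = normal_distribution 0 v"
    by (simp add: distributed_def normal_distribution_def)
  then have "char (normal_distribution 0 v) x = (CLINT y|distr std_normal_distribution lborel (\<lambda>x. sqrt v * x). iexp (x * y))"
    by (simp add: char_def)
  also have "\<dots> = char std_normal_distribution (x * sqrt v)"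
    by (simp add: integral_distr char_def mult_ac)
  also have "\<dots> = exp (- (v * x\<^sup>2) / 2)"
    using assms by (simp add: char_std_normal_distribution power_mult_distrib mult_ac)
  finally show ?thesis .
qed

lemma norm_power_add_le:
  fixes x y :: complex
  shows "norm (x + y) ^ 2 \<le> 2 * norm x ^ 2 + 2 * norm y ^ 2"
    and "norm (x + y) ^ 3 \<le> 4 * norm x ^ 3 + 4 * norm y ^ 3"
proof -
  have "(r + s) ^ 2 \<le> 2 * r ^ 2 + 2 * s ^ 2" for r s :: real
    using zero_le_power2[of "r - s"] by (simp add: power2_eq_square algebra_simps)
  then show "norm (x + y) ^ 2 \<le> 2 * norm x ^ 2 + 2 * norm y ^ 2"
    by (meson norm_ge_zero norm_triangle_ineq order_trans power_mono)
  have "(r + s) ^ 3 \<le> 4 * r ^ 3 + 4 * s ^ 3" if "0 \<le> r" "0 \<le> s" for r s :: real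
  proof -
    have "4 * r ^ 3 + 4 * s ^ 3 - (r + s) ^ 3 = 3 * (r + s) * (r - s) ^ 2"
      by (simp add: power2_eq_square power3_eq_cube algebra_simps)
    moreover have "0 \<le> 3 * (r + s) * (r - s) ^ 2" using that by simp
    ultimately show ?thesis by linarith
  qed
  then show "norm (x + y) ^ 3 \<le> 4 * norm x ^ 3 + 4 * norm y ^ 3"
    by (meson norm_ge_zero norm_triangle_ineq order_trans power_mono)
qed

context marked_hawkes
begin

section \<open>Second-order expansion of the mark transform\<close>

abbreviation mark_moment where "mark_moment i \<equiv> expectation (\<lambda>\<omega>. l 1 1 \<omega> ^ i)"

lemma mark_moment_nonneg: "0 \<le> mark_moment i"
  using marks_pos[of 1 1] by (intro integral_nonneg_AE) auto

lemma mark_exponent_moments: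
  fixes \<theta> :: real and z :: complex
  assumes int: "\<And>i. i \<in> {1..3} \<Longrightarrow> integrable M (\<lambda>\<omega>. l 1 1 \<omega> ^ i)"
  defines "w \<equiv> \<lambda>\<omega>. \<i> * \<theta> + z * l 1 1 \<omega>"
  shows "has_bochner_integral M w (\<i> * \<theta> + mark_moment 1 * z)"
    and "has_bochner_integral M (\<lambda>\<omega>. w \<omega> ^ 2) (- (\<theta>\<^sup>2) + 2 * \<i> * \<theta> * mark_moment 1 * z + mark_moment 2 * z\<^sup>2)"
proof -
  have const: "has_bochner_integral M (\<lambda>_. k) k" for k :: complex
    by (simp add: has_bochner_integral_iff prob_space)
  have mom: "has_bochner_integral M (\<lambda>\<omega>. k * of_real (l 1 1 \<omega> ^ i)) (k * of_real (mark_moment i))"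
    if "i \<in> {1..3}" for i and k :: complex
    using int[OF that] by (simp add: has_bochner_integral_iff del: of_real_power)
  have "has_bochner_integral M (\<lambda>\<omega>. \<i> * \<theta> + z * of_real (l 1 1 \<omega> ^ 1)) (\<i> * \<theta> + z * of_real (mark_moment 1))"
    by (intro has_bochner_integral_add const mom) simp
  then show "has_bochner_integral M w (\<i> * \<theta> + mark_moment 1 * z)"
    by (simp add: w_def mult.commute)
  have "has_bochner_integral M (\<lambda>\<omega>. - (\<theta>\<^sup>2) + 2 * \<i> * \<theta> * z * of_real (l 1 1 \<omega> ^ 1) + z\<^sup>2 * of_real (l 1 1 \<omega> ^ 2))
     (- (\<theta>\<^sup>2) + 2 * \<i> * \<theta> * z * of_real (mark_moment 1) + z\<^sup>2 * of_real (mark_moment 2))"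
    by (intro has_bochner_integral_add const mom) simp_all
  moreover have "w \<omega> ^ 2 = - (\<theta>\<^sup>2) + 2 * \<i> * \<theta> * z * of_real (l 1 1 \<omega> ^ 1) + z\<^sup>2 * of_real (l 1 1 \<omega> ^ 2)" for \<omega>
    by (simp add: w_def power2_eq_square algebra_simps)
  ultimately show "has_bochner_integral M (\<lambda>\<omega>. w \<omega> ^ 2) (- (\<theta>\<^sup>2) + 2 * \<i> * \<theta> * mark_moment 1 * z + mark_moment 2 * z\<^sup>2)"
    by (simp add: mult_ac)
qed

lemma norm_integral_le:
  fixes f :: "'a \<Rightarrow> complex"
  assumes "integrable M f" "has_bochner_integral M g I" "AE \<omega> in M. norm (f \<omega>) \<le> g \<omega>"
  shows "norm (CLINT \<omega>|M. f \<omega>) \<le> I"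
proof -
  have "norm (CLINT \<omega>|M. f \<omega>) \<le> (\<integral>\<omega>. norm (f \<omega>) \<partial>M)" by (rule integral_norm_bound)
  also have "\<dots> \<le> (\<integral>\<omega>. g \<omega> \<partial>M)"
    using assms by (intro integral_mono_AE) (auto simp: has_bochner_integral_iff)
  finally show ?thesis using assms(2) by (simp add: has_bochner_integral_iff)
qed

text \<open>Almost surely \<open>w\<close> lies in the closed left half-plane, so the Taylor bounds
  of orders 0, 1 and 2 hold pointwise and can be integrated.\<close>

lemma mark_pgf_expansion:
  fixes \<theta> :: real and z :: complex
  assumes int: "\<And>i. i \<in> {1..3} \<Longrightarrow> integrable M (\<lambda>\<omega>. l 1 1 \<omega> ^ i)" and z: "Re z \<le> 0"
  shows "norm (mark_pgf \<theta> z - 1) \<le> \<bar>\<theta>\<bar> + mark_moment 1 * norm z"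
    and "norm (mark_pgf \<theta> z - 1 - (\<i> * \<theta> + mark_moment 1 * z)) \<le> 2 * \<theta>\<^sup>2 + 2 * mark_moment 2 * (norm z)\<^sup>2"
    and "norm (mark_pgf \<theta> z - 1 - (\<i> * \<theta> + mark_moment 1 * z)
          - (- (\<theta>\<^sup>2) + 2 * \<i> * \<theta> * mark_moment 1 * z + mark_moment 2 * z\<^sup>2) / 2)
      \<le> 2 * (1 + mark_moment 3) * (\<bar>\<theta>\<bar> ^ 3 + norm z ^ 3)"
proof -
  define w where "w \<omega> = \<i> * \<theta> + z * l 1 1 \<omega>" for \<omega>
  have pos: "AE \<omega> in M. 0 < l 1 1 \<omega>" by (rule marks_pos) auto
  have Re_w: "AE \<omega> in M. Re (w \<omega>) \<le> 0"
    using pos by eventually_elim (use z in \<open>simp add: w_def mult_nonpos_nonneg\<close>)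
  have const: "has_bochner_integral M (\<lambda>_. k) k" for k :: real
    by (simp add: has_bochner_integral_iff prob_space)
  have mom: "has_bochner_integral M (\<lambda>\<omega>. k * l 1 1 \<omega> ^ i) (k * mark_moment i)" if "i \<in> {1..3}" for i and k :: real
    using int[OF that] by (simp add: has_bochner_integral_iff)
  have e: "integrable M (\<lambda>\<omega>. exp (w \<omega>))" "(CLINT \<omega>|M. exp (w \<omega>)) = mark_pgf \<theta> z"
    using integrable_exp_mark[OF z, of 1 1 \<theta>] by (simp_all add: w_def mark_pgf_def)
  note w = mark_exponent_moments[OF int, of \<theta> z, folded w_def]
  have w1: "integrable M w" "(CLINT \<omega>|M. w \<omega>) = \<i> * \<theta> + mark_moment 1 * z"
    and w2: "integrable M (\<lambda>\<omega>. w \<omega> ^ 2)"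
      "(CLINT \<omega>|M. w \<omega> ^ 2) = - (\<theta>\<^sup>2) + 2 * \<i> * \<theta> * mark_moment 1 * z + mark_moment 2 * z\<^sup>2"
    using w by (auto simp: has_bochner_integral_iff)
  have "norm (CLINT \<omega>|M. exp (w \<omega>) - 1) \<le> \<bar>\<theta>\<bar> + norm z * mark_moment 1"
  proof (rule norm_integral_le)
    show "has_bochner_integral M (\<lambda>\<omega>. \<bar>\<theta>\<bar> + norm z * l 1 1 \<omega> ^ 1) (\<bar>\<theta>\<bar> + norm z * mark_moment 1)"
      by (intro has_bochner_integral_add const mom) simp
    show "AE \<omega> in M. norm (exp (w \<omega>) - 1) \<le> \<bar>\<theta>\<bar> + norm z * l 1 1 \<omega> ^ 1"
      using pos Re_w
    proof eventually_elim
      case (elim \<omega>)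
      have "norm (exp (w \<omega>) - 1) \<le> norm (w \<omega>)"
        using norm_exp_diff_taylor_le[OF elim(2), of 0] by simp
      also have "\<dots> \<le> \<bar>\<theta>\<bar> + norm z * l 1 1 \<omega> ^ 1"
        unfolding w_def using elim(1) by (intro norm_triangle_le) (simp add: norm_mult)
      finally show ?case .
    qed
  qed (use e in simp)
  then show "norm (mark_pgf \<theta> z - 1) \<le> \<bar>\<theta>\<bar> + mark_moment 1 * norm z"
    using e by (simp add: prob_space mult.commute)
  have "norm (CLINT \<omega>|M. exp (w \<omega>) - 1 - w \<omega>) \<le> 2 * \<theta>\<^sup>2 + 2 * (norm z)\<^sup>2 * mark_moment 2"
  proof (rule norm_integral_le)
    show "has_bochner_integral M (\<lambda>\<omega>. 2 * \<theta>\<^sup>2 + 2 * (norm z)\<^sup>2 * l 1 1 \<omega> ^ 2) (2 * \<theta>\<^sup>2 + 2 * (norm z)\<^sup>2 * mark_moment 2)"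
      by (intro has_bochner_integral_add const mom) simp
    show "AE \<omega> in M. norm (exp (w \<omega>) - 1 - w \<omega>) \<le> 2 * \<theta>\<^sup>2 + 2 * (norm z)\<^sup>2 * l 1 1 \<omega> ^ 2"
      using Re_w
    proof eventually_elim
      case (elim \<omega>)
      have "norm (exp (w \<omega>) - 1 - w \<omega>) \<le> norm (w \<omega>) ^ 2"
        using norm_exp_diff_taylor_le[OF elim, of 1] by (simp add: power2_eq_square diff_diff_eq)
      also have "\<dots> \<le> 2 * \<theta>\<^sup>2 + 2 * (norm z)\<^sup>2 * l 1 1 \<omega> ^ 2"
        unfolding w_def using norm_power_add_le(1)[of "\<i> * \<theta>" "z * l 1 1 \<omega>"]
        by (simp add: norm_mult power_mult_distrib mult.assoc)
      finally show ?case .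
    qed
  qed (use e w1 in simp)
  then show "norm (mark_pgf \<theta> z - 1 - (\<i> * \<theta> + mark_moment 1 * z)) \<le> 2 * \<theta>\<^sup>2 + 2 * mark_moment 2 * (norm z)\<^sup>2"
    using e w1 by (simp add: prob_space mult_ac)
  have "norm (CLINT \<omega>|M. exp (w \<omega>) - 1 - w \<omega> - w \<omega> ^ 2 / 2) \<le> 2 * \<bar>\<theta>\<bar> ^ 3 + 2 * norm z ^ 3 * mark_moment 3"
  proof (rule norm_integral_le)
    show "has_bochner_integral M (\<lambda>\<omega>. 2 * \<bar>\<theta>\<bar> ^ 3 + 2 * norm z ^ 3 * l 1 1 \<omega> ^ 3) (2 * \<bar>\<theta>\<bar> ^ 3 + 2 * norm z ^ 3 * mark_moment 3)"
      by (intro has_bochner_integral_add const mom) simp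
    show "AE \<omega> in M. norm (exp (w \<omega>) - 1 - w \<omega> - w \<omega> ^ 2 / 2) \<le> 2 * \<bar>\<theta>\<bar> ^ 3 + 2 * norm z ^ 3 * l 1 1 \<omega> ^ 3"
      using pos Re_w
    proof eventually_elim
      case (elim \<omega>)
      \<comment> \<open>The half is \<open>1 / fact 2\<close>; with the factor 4 of
        \<open>norm_power_add_le\<close> it gives the constant 2.\<close>
      have "norm (exp (w \<omega>) - 1 - w \<omega> - w \<omega> ^ 2 / 2) \<le> norm (w \<omega>) ^ 3 / 2"
        using norm_exp_diff_taylor_le[OF elim(2), of 2]
        by (simp add: numeral_2_eq_2 numeral_3_eq_3 diff_diff_eq)
      also have "\<dots> \<le> 2 * \<bar>\<theta>\<bar> ^ 3 + 2 * norm z ^ 3 * l 1 1 \<omega> ^ 3"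
        unfolding w_def using norm_power_add_le(2)[of "\<i> * \<theta>" "z * l 1 1 \<omega>"] elim(1)
        by (simp add: norm_mult power_mult_distrib mult.assoc)
      finally show ?case .
    qed
  qed (use e w1 w2 in simp)
  \<comment> \<open>Adding nonnegative cross terms gives the product shape that
    \<open>h_quad\<close> asks for.\<close>
  also have "2 * \<bar>\<theta>\<bar> ^ 3 + 2 * norm z ^ 3 * mark_moment 3 \<le> 2 * (1 + mark_moment 3) * (\<bar>\<theta>\<bar> ^ 3 + norm z ^ 3)"
    using mark_moment_nonneg[of 3] by (simp add: algebra_simps)
  finally show "norm (mark_pgf \<theta> z - 1 - (\<i> * \<theta> + mark_moment 1 * z)
          - (- (\<theta>\<^sup>2) + 2 * \<i> * \<theta> * mark_moment 1 * z + mark_moment 2 * z\<^sup>2) / 2)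
      \<le> 2 * (1 + mark_moment 3) * (\<bar>\<theta>\<bar> ^ 3 + norm z ^ 3)"
    using e w1 w2 by (simp add: prob_space)
qed

section \<open>Kernel tails and the renewal equation of the process\<close>

abbreviation kernel_tail where "kernel_tail k \<equiv> \<Sum>\<^sub>\<infinity>s\<in>{1 + k..}. \<alpha> s"

lemma kernel_tail_nonneg: "0 \<le> kernel_tail k"
  by (intro infsum_nonneg less_imp_le[OF exciting_pos])

lemma kernel_partial_sums: "(\<Sum>i=1..k. \<alpha> i) = l1_norm \<alpha> - kernel_tail k"
proof -
  have "{1..} = {1..k} \<union> {1 + k..}" by auto
  then have "l1_norm \<alpha> = infsum \<alpha> ({1..k} \<union> {1 + k..})" by (simp only: l1_norm_def)
  also have "\<dots> = infsum \<alpha> {1..k} + kernel_tail k"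
    by (intro infsum_Un_disjoint summable_on_subset_banach[OF exciting_summable]) auto
  finally show ?thesis by simp
qed

lemma perturbed_renewal_hawkes:
  assumes "\<And>i. i \<in> {1..3} \<Longrightarrow> integrable M (\<lambda>\<omega>. l 1 1 \<omega> ^ i)"
  shows "perturbed_renewal \<alpha> kernel_tail (l1_norm \<alpha>) (mark_moment 1) (mark_moment 2) (2 * (1 + mark_moment 3))
           \<theta> (hawkes_coeff \<theta>) (hawkes_conv \<theta>)"
proof
  show "l1_norm \<alpha> * mark_moment 1 < 1" using subcritical by simp
  note * = mark_pgf_expansion[OF assms Re_hawkes_conv, of \<theta> \<theta>]
  show "cmod (hawkes_coeff \<theta> k) \<le> \<bar>\<theta>\<bar> + mark_moment 1 * cmod (hawkes_conv \<theta> k)"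
    "cmod (hawkes_coeff \<theta> k - (\<i> * \<theta> + mark_moment 1 * hawkes_conv \<theta> k))
         \<le> 2 * \<theta>\<^sup>2 + 2 * mark_moment 2 * (cmod (hawkes_conv \<theta> k))\<^sup>2"
    "cmod (hawkes_coeff \<theta> k - (\<i> * \<theta> + mark_moment 1 * hawkes_conv \<theta> k) -
              (- (\<theta>\<^sup>2) + 2 * \<i> * \<theta> * mark_moment 1 * hawkes_conv \<theta> k + mark_moment 2 * (hawkes_conv \<theta> k)\<^sup>2) / 2)
         \<le> 2 * (1 + mark_moment 3) * (\<bar>\<theta>\<bar> ^ 3 + cmod (hawkes_conv \<theta> k) ^ 3)" for k
    using *[of k] unfolding hawkes_coeff_eq[of \<theta> k] by simp_all
  show "0 \<le> mark_moment 1" by (rule mark_moment_nonneg)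
  show "0 \<le> 2 * (1 + mark_moment 3)" using mark_moment_nonneg[of 3] by simp
qed (simp_all add: kernel_tail_nonneg kernel_partial_sums mark_moment_nonneg hawkes_conv_def less_imp_le[OF exciting_pos] del: One_nat_def)

section \<open>The limit variance and the limit of the exponent\<close>

definition count_variance :: real where
  "count_variance = \<nu> * (1 + (l1_norm \<alpha>)\<^sup>2 * variance (l 1 1)) / (1 - l1_norm \<alpha> * expectation (l 1 1)) ^ 3"

lemma count_variance_pos: "0 < count_variance"
proof -
  have "0 \<le> (l1_norm \<alpha>)\<^sup>2 * variance (l 1 1)"
    by (intro mult_nonneg_nonneg integral_nonneg_AE) auto
  then have "0 < 1 + (l1_norm \<alpha>)\<^sup>2 * variance (l 1 1)" by linarith
  then show ?thesis
    unfolding count_variance_def using base_pos subcritical by (intro divide_pos_pos mult_pos_pos zero_less_power) linarith+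
qed

text \<open>The right-hand side is the form delivered by \<open>sum_expansion\<close>. Writing the
  second moment as \<open>m\<^sup>2 + V\<close> and completing the square leaves
  \<open>(1 + m * y)\<^sup>2 + V * y\<^sup>2\<close>; at \<open>y = a * \<mu>\<close> the first
  square is \<open>\<mu>\<^sup>2\<close>.\<close>

lemma count_variance_eq:
  assumes "integrable M (\<lambda>\<omega>. l 1 1 \<omega> ^ 2)"
  defines "\<mu> \<equiv> 1 / (1 - l1_norm \<alpha> * mark_moment 1)"
  shows "count_variance = \<nu> * \<mu> * (1 + 2 * mark_moment 1 * (l1_norm \<alpha> * \<mu>) + mark_moment 2 * (l1_norm \<alpha> * \<mu>)\<^sup>2)"
proof -
  define a m V where "a = l1_norm \<alpha>" and "m = mark_moment 1" and "V = variance (l 1 1)"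
  have V: "mark_moment 2 = m\<^sup>2 + V"
    using variance_eq[OF marks_integrable assms(1)] by (simp add: V_def m_def)
  have "1 + m * (a * \<mu>) = \<mu>"
    using subcritical by (simp add: \<mu>_def a_def m_def field_simps)
  moreover have "1 + 2 * m * y + (m\<^sup>2 + V) * y\<^sup>2 = (1 + m * y)\<^sup>2 + V * y\<^sup>2" for y
    by (simp add: power2_eq_square algebra_simps)
  ultimately have "1 + 2 * m * (a * \<mu>) + (m\<^sup>2 + V) * (a * \<mu>)\<^sup>2 = \<mu>\<^sup>2 + V * (a * \<mu>)\<^sup>2"
    by simp
  then have "\<nu> * \<mu> * (1 + 2 * m * (a * \<mu>) + (m\<^sup>2 + V) * (a * \<mu>)\<^sup>2) = \<nu> * (1 + a\<^sup>2 * V) * \<mu> ^ 3"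
    by (simp add: power2_eq_square power3_eq_cube algebra_simps)
  also have "\<dots> = count_variance"
    by (simp add: count_variance_def \<mu>_def a_def m_def V_def power_one_over)
  finally show ?thesis unfolding V by (simp only: a_def m_def)
qed

text \<open>This is \<open>sum_expansion\<close> at \<open>\<theta> = x / sqrt n\<close>, multiplied
  by \<open>\<nu> * \<mu>\<close>, which cancels the factor \<open>1 - a * m\<close>.\<close>

lemma hawkes_coeff_sum_tendsto:
  assumes int: "\<And>i. i \<in> {1..3} \<Longrightarrow> integrable M (\<lambda>\<omega>. l 1 1 \<omega> ^ i)"
    and tail: "(\<lambda>t. 1 / sqrt (real t) * (\<Sum>u = 1..t - 1. kernel_tail u)) \<longlonglongrightarrow> 0"
  defines "\<mu> \<equiv> 1 / (1 - l1_norm \<alpha> * mark_moment 1)"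
  shows "(\<lambda>n. \<nu> * (\<Sum>k<n. hawkes_coeff (x / sqrt n) k) - \<i> * (x * \<nu> * \<mu> * sqrt n))
           \<longlonglongrightarrow> of_real (- (count_variance * x\<^sup>2) / 2)"
proof -
  define a m q K where "a = l1_norm \<alpha>" and "m = mark_moment 1" and "q = mark_moment 2"
    and "K = 2 * (1 + mark_moment 3)"
  define b where "b = a * \<mu>"
  define \<theta> where "\<theta> n = x / sqrt (real n)" for n
  define S where "S n = (\<Sum>k<n. kernel_tail k)" for n
  define H where "H n = (\<Sum>k<n. hawkes_coeff (\<theta> n) k)" for n
  \<comment> \<open>The error bound of \<open>sum_expansion\<close>, regrouped into
    \<open>\<bar>\<theta> n\<bar>\<close>, \<open>\<bar>\<theta> n\<bar> * S n\<close> and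
    \<open>(\<theta> n)\<^sup>2 * n\<close>, whose limits are 0, 0 and
    \<open>x\<^sup>2\<close>.\<close>
  define B where "B n = m * \<mu> * (\<bar>\<theta> n\<bar> * S n)
      + (m + q * b) * \<bar>\<theta> n\<bar> * (\<mu>\<^sup>2 * (\<bar>\<theta> n\<bar> * S n) + b * (2 + 2 * q * b\<^sup>2) * ((\<theta> n)\<^sup>2 * n))
      + K * (1 + b ^ 3) * (\<bar>\<theta> n\<bar> * ((\<theta> n)\<^sup>2 * n))" for n
  have am: "1 - a * m > 0" using subcritical by (simp add: a_def m_def)
  have bound: "norm ((1 - a * m) * H n - (\<i> * \<theta> n * n - of_real (n * ((\<theta> n)\<^sup>2 * (1 + 2 * m * b + q * b\<^sup>2)) / 2))) \<le> B n" for n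
  proof -
    interpret R: perturbed_renewal \<alpha> kernel_tail a m q K "\<theta> n" "hawkes_coeff (\<theta> n)" "hawkes_conv (\<theta> n)"
      unfolding a_def m_def q_def K_def by (rule perturbed_renewal_hawkes[OF int])
    have \<mu>: "R.\<mu> = \<mu>" unfolding R.\<mu>_def unfolding \<mu>_def a_def m_def ..
    moreover have "R.b = b" unfolding R.b_def \<mu> b_def ..
    moreover have "R.S n = S n" unfolding R.S_def S_def ..
    moreover have "\<bar>\<theta> n\<bar> ^ 3 = \<bar>\<theta> n\<bar> * (\<theta> n)\<^sup>2"
      by (simp add: power3_eq_cube power2_eq_square mult.assoc)
    ultimately show ?thesis
      using R.sum_expansion[of n] by (simp add: H_def B_def mult.assoc)
  qed
  have sqrt0: "(\<lambda>n. 1 / sqrt (real n)) \<longlonglongrightarrow> 0"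
    by (intro tendsto_divide_0[OF tendsto_const] filterlim_at_top_imp_at_infinity
        filterlim_compose[OF sqrt_at_top filterlim_real_sequentially])
  have "\<theta> \<longlonglongrightarrow> 0"
    unfolding \<theta>_def using tendsto_mult_right_zero[OF sqrt0, of x] by simp
  then have \<theta>0: "(\<lambda>n. \<bar>\<theta> n\<bar>) \<longlonglongrightarrow> 0" by (rule tendsto_rabs_zero)
  have \<theta>2: "(\<lambda>n. (\<theta> n)\<^sup>2 * n) \<longlonglongrightarrow> x\<^sup>2"
  \<comment> \<open>At \<open>n = 0\<close> division by zero makes the left side 0, so equality is
    claimed only eventually.\<close>
  proof (rule tendsto_eventually, rule eventually_mono[OF eventually_gt_at_top[of 0]])
    show "(\<theta> n)\<^sup>2 * n = x\<^sup>2" if "0 < n" for n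
      using that by (simp add: \<theta>_def power_divide)
  qed
  \<comment> \<open>The tail hypothesis sums from \<open>u = 1\<close>, while \<open>S\<close>
    starts at 0. The additional term \<open>kernel_tail 0 / sqrt n\<close> vanishes in the
    limit.\<close>
  have "(\<lambda>n. \<bar>x\<bar> * (kernel_tail 0 * (1 / sqrt n) + 1 / sqrt (real n) * (\<Sum>u = 1..n - 1. kernel_tail u))) \<longlonglongrightarrow> \<bar>x\<bar> * (kernel_tail 0 * 0 + 0)"
    by (intro tendsto_intros tail sqrt0)
  moreover have "\<forall>\<^sub>F n in sequentially. \<bar>x\<bar> * (kernel_tail 0 * (1 / sqrt n) + 1 / sqrt (real n) * (\<Sum>u = 1..n - 1. kernel_tail u)) = \<bar>\<theta> n\<bar> * S n"
  proof (rule eventually_mono[OF eventually_gt_at_top[of 0]])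
    fix n :: nat assume "0 < n"
    then have "{..<n} = insert 0 {1..n - 1}" by auto
    then have "S n = kernel_tail 0 + (\<Sum>u = 1..n - 1. kernel_tail u)" by (simp add: S_def)
    then show "\<bar>x\<bar> * (kernel_tail 0 * (1 / sqrt n) + 1 / sqrt (real n) * (\<Sum>u = 1..n - 1. kernel_tail u)) = \<bar>\<theta> n\<bar> * S n"
      by (simp add: \<theta>_def add_divide_distrib distrib_left del: One_nat_def)
  qed
  ultimately have \<theta>S: "(\<lambda>n. \<bar>\<theta> n\<bar> * S n) \<longlonglongrightarrow> 0"
    by (rule Lim_transform_eventually[THEN tendsto_eq_rhs]) simp
  have "B \<longlonglongrightarrow> m * \<mu> * 0 + (m + q * b) * 0 * (\<mu>\<^sup>2 * 0 + b * (2 + 2 * q * b\<^sup>2) * x\<^sup>2) + K * (1 + b ^ 3) * (0 * x\<^sup>2)"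
    unfolding B_def by (intro tendsto_intros \<theta>0 \<theta>2 \<theta>S)
  then have B0: "B \<longlonglongrightarrow> 0" by simp
  have "(\<lambda>n. (1 - a * m) * H n - (\<i> * \<theta> n * n - of_real (n * ((\<theta> n)\<^sup>2 * (1 + 2 * m * b + q * b\<^sup>2)) / 2))) \<longlonglongrightarrow> 0"
    by (rule Lim_null_comparison[OF always_eventually[OF allI[OF bound]] B0])
  moreover have "(\<lambda>n. complex_of_real ((\<theta> n)\<^sup>2 * n * (1 + 2 * m * b + q * b\<^sup>2) / 2)) \<longlonglongrightarrow> of_real (x\<^sup>2 * (1 + 2 * m * b + q * b\<^sup>2) / 2)"
    by (intro tendsto_intros \<theta>2) simp
  ultimately have lim: "(\<lambda>n. of_real (\<nu> * \<mu>) * (((1 - a * m) * H n - (\<i> * \<theta> n * n - of_real (n * ((\<theta> n)\<^sup>2 * (1 + 2 * m * b + q * b\<^sup>2)) / 2)))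
      - of_real ((\<theta> n)\<^sup>2 * n * (1 + 2 * m * b + q * b\<^sup>2) / 2)))
      \<longlonglongrightarrow> of_real (\<nu> * \<mu>) * (0 - of_real (x\<^sup>2 * (1 + 2 * m * b + q * b\<^sup>2) / 2))"
    by (intro tendsto_mult tendsto_const tendsto_diff)
  have eq: "of_real (\<nu> * \<mu>) * (((1 - a * m) * H n - (\<i> * \<theta> n * n - of_real (n * ((\<theta> n)\<^sup>2 * (1 + 2 * m * b + q * b\<^sup>2)) / 2)))
      - of_real ((\<theta> n)\<^sup>2 * n * (1 + 2 * m * b + q * b\<^sup>2) / 2)) = \<nu> * H n - \<i> * (x * \<nu> * \<mu> * sqrt n)" for n
  proof -
    define w where "w = complex_of_real ((\<theta> n)\<^sup>2 * n * (1 + 2 * m * b + q * b\<^sup>2) / 2)"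
    have "\<mu> * (1 - a * m) = 1" using am by (simp add: \<mu>_def a_def m_def)
    then have 1: "of_real \<mu> * (of_real (1 - a * m) * H n) = H n"
      by (simp only: mult.assoc[symmetric] of_real_mult[symmetric]) simp
    have "\<theta> n * n = x * (n / sqrt n)" by (simp add: \<theta>_def)
    \<comment> \<open>This covers \<open>n = 0\<close> as well, where both sides are 0.\<close>
    then have 2: "\<theta> n * real n = x * sqrt n" by (simp add: real_div_sqrt)
    have 3: "of_real (n * ((\<theta> n)\<^sup>2 * (1 + 2 * m * b + q * b\<^sup>2)) / 2) = w"
      by (simp add: w_def mult_ac)
    have "of_real (\<nu> * \<mu>) * ((of_real (1 - a * m) * H n - (\<i> * \<theta> n * n - w)) - w)
        = \<nu> * (of_real \<mu> * (of_real (1 - a * m) * H n)) - \<i> * of_real (\<nu> * \<mu> * (\<theta> n * real n))"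
      by (simp add: algebra_simps)
    also have "\<dots> = \<nu> * H n - \<i> * (x * \<nu> * \<mu> * sqrt n)"
      unfolding 1 2 by (simp add: mult_ac)
    finally show ?thesis unfolding 3 w_def[symmetric] by simp
  qed
  have limit_eq: "of_real (\<nu> * \<mu>) * (0 - of_real (x\<^sup>2 * (1 + 2 * m * b + q * b\<^sup>2) / 2)) = complex_of_real (- (count_variance * x\<^sup>2) / 2)"
    using count_variance_eq[OF int[of 2]] by (simp add: \<mu>_def m_def a_def q_def b_def algebra_simps)
  show ?thesis using lim unfolding eq limit_eq unfolding H_def \<theta>_def .
qed

text \<open>Centering multiplies the characteristic function by a phase of order
  \<open>sqrt t\<close>, which cancels the diverging imaginary part of the exponent found in
  \<open>hawkes_coeff_sum_tendsto\<close>.\<close>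

theorem count_clt:
  assumes int: "\<And>i. i \<in> {1..3} \<Longrightarrow> integrable M (\<lambda>\<omega>. l 1 1 \<omega> ^ i)"
    and tail: "(\<lambda>t. 1 / sqrt (real t) * (\<Sum>u = 1..t - 1. kernel_tail u)) \<longlonglongrightarrow> 0"
  shows "weak_conv_m
    (\<lambda>t. distr M borel (\<lambda>\<omega>. 1 / sqrt (real t) *
       (real (count_upto Z t \<omega>) - \<nu> * real t / (1 - l1_norm \<alpha> * expectation (l 1 1)))))
    (normal_distribution 0 count_variance)"
proof (rule levy_continuity)
  \<comment> \<open>The long-run number of events per unit time.\<close>
  define \<kappa> where "\<kappa> = \<nu> / (1 - l1_norm \<alpha> * mark_moment 1)"
  have meas[measurable]: "(\<lambda>\<omega>. real (count_upto Z t \<omega>)) \<in> borel_measurable M" for t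
    unfolding count_upto_def of_nat_sum
    by (intro borel_measurable_sum measurable_compose[OF counts_measurable]) auto
  show "real_distribution (distr M borel (\<lambda>\<omega>. 1 / sqrt (real t) *
       (real (count_upto Z t \<omega>) - \<nu> * real t / (1 - l1_norm \<alpha> * expectation (l 1 1)))))" for t
    by (intro real_distribution_distr) measurable
  show "real_distribution (normal_distribution 0 count_variance)"
    by (rule real_distribution_normal[OF count_variance_pos])
  fix x
  have "char (distr M borel (\<lambda>\<omega>. 1 / sqrt (real t) *
       (real (count_upto Z t \<omega>) - \<nu> * real t / (1 - l1_norm \<alpha> * expectation (l 1 1))))) x
     = exp (\<nu> * (\<Sum>k<t. hawkes_coeff (x / sqrt t) k) - \<i> * (x * \<nu> * (1 / (1 - l1_norm \<alpha> * mark_moment 1)) * sqrt t))" for t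
  proof -
    have "x * (1 / sqrt (real t) * (N - \<nu> * real t / D)) = x / sqrt t * N - x * (\<nu> / D) * (real t / sqrt t)" for N D
      by (simp add: right_diff_distrib mult_ac)
    then have eq: "x * (1 / sqrt (real t) * (N - \<nu> * real t / (1 - l1_norm \<alpha> * expectation (l 1 1))))
        = x / sqrt t * N - x * \<kappa> * sqrt t" for N
      by (simp add: \<kappa>_def real_div_sqrt del: One_nat_def)
    have "char (distr M borel (\<lambda>\<omega>. 1 / sqrt (real t) *
       (real (count_upto Z t \<omega>) - \<nu> * real t / (1 - l1_norm \<alpha> * expectation (l 1 1))))) x
       = (CLINT \<omega>|M. iexp (x * (1 / sqrt (real t) *
           (real (count_upto Z t \<omega>) - \<nu> * real t / (1 - l1_norm \<alpha> * expectation (l 1 1))))))"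
      by (simp add: char_def integral_distr)
    also have "\<dots> = (CLINT \<omega>|M. iexp (x / sqrt t * count_upto Z t \<omega> - x * \<kappa> * sqrt t))"
      by (simp only: eq)
    also have "\<dots> = (CLINT \<omega>|M. exp (\<i> * (x / sqrt t) * count_upto Z t \<omega>) * iexp (- (x * \<kappa> * sqrt t)))"
      by (simp add: mult_exp_exp algebra_simps)
    also have "\<dots> = exp (\<nu> * (\<Sum>k<t. hawkes_coeff (x / sqrt t) k)) * iexp (- (x * \<kappa> * sqrt t))"
      using integral_exp_count[of "x / sqrt t" t] by simp
    also have "\<dots> = exp (\<nu> * (\<Sum>k<t. hawkes_coeff (x / sqrt t) k) - \<i> * (x * \<nu> * (1 / (1 - l1_norm \<alpha> * mark_moment 1)) * sqrt t))"
      by (simp add: mult_exp_exp \<kappa>_def)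
    finally show ?thesis .
  qed
  moreover have "(\<lambda>t. exp (\<nu> * (\<Sum>k<t. hawkes_coeff (x / sqrt t) k) - \<i> * (x * \<nu> * (1 / (1 - l1_norm \<alpha> * mark_moment 1)) * sqrt t)))
      \<longlonglongrightarrow> exp (of_real (- (count_variance * x\<^sup>2) / 2))"
    by (intro tendsto_exp hawkes_coeff_sum_tendsto[OF int tail])
  ultimately show "(\<lambda>t. char (distr M borel (\<lambda>\<omega>. 1 / sqrt (real t) *
       (real (count_upto Z t \<omega>) - \<nu> * real t / (1 - l1_norm \<alpha> * expectation (l 1 1))))) x)
      \<longlonglongrightarrow> char (normal_distribution 0 count_variance) x"
    unfolding char_normal_distribution_0[OF count_variance_pos] by (simp only: exp_of_real)
qed

end

theorem theorem2p3:
  fixes M :: "'a measure" and \<nu> :: real and \<alpha> :: "nat \<Rightarrow> real"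
    and l :: "nat \<Rightarrow> nat \<Rightarrow> 'a \<Rightarrow> real" and Z :: "nat \<Rightarrow> 'a \<Rightarrow> nat"
  assumes "marked_hawkes M \<nu> \<alpha> l Z"
    and "\<And>t j k. \<lbrakk>1 \<le> t; 1 \<le> j; k \<in> {1..4}\<rbrakk> \<Longrightarrow> integrable M (\<lambda>\<omega>. l t j \<omega> ^ k)"
    and "(\<lambda>t. 1 / sqrt (real t) * (\<Sum>u = 1..t - 1. \<Sum>\<^sub>\<infinity>s\<in>{1 + u..}. \<alpha> s)) \<longlonglongrightarrow> 0"
  shows "weak_conv_m
    (\<lambda>t. distr M borel (\<lambda>\<omega>. 1 / sqrt (real t) *
       (real (count_upto Z t \<omega>) -
        \<nu> * real t / (1 - l1_norm \<alpha> * prob_space.expectation M (l 1 1)))))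
    (normal_distribution 0
       (\<nu> * (1 + (l1_norm \<alpha>)\<^sup>2 * prob_space.variance M (l 1 1)) /
        (1 - l1_norm \<alpha> * prob_space.expectation M (l 1 1)) ^ 3))"
proof -
  interpret marked_hawkes M \<nu> \<alpha> l Z by fact
  show ?thesis
    using count_clt[OF assms(2) assms(3)] unfolding count_variance_def by auto
qed

end
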